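(* Let $p$ be a prime number, let $r$ be a positive integer, and let $\Delta \subset \mathbb{R}^d$ be a $d$-dimensional lattice simplex with normalized volume $p$. Suppose that $\Delta$ is not a lattice pyramid over any lower-dimensional lattice simplex. Then $\Delta$ is Gorenstein of index $r$ if and only if $d = rp-1$ and $\Lambda_\Delta$ is generated by $\left(\frac{1}{p},\ldots,\frac{1}{p}\right) \in (\mathbb{R}/\mathbb{Z})^{d+1}$.
   Context: A lattice polytope is a convex polytope all of whose vertices have integer coordinates. The normalized volume $\mathrm{Vol}(\mathcal{P})$ of a $d$-dimensional lattice polytope $\mathcal{P}\subset\mathbb{R}^d$ is $d!$ times its Euclidean volume. For a $d$-dimensional lattice simplex $\Delta \subset \mathbb{R}^d$ with vertices $v_0,\ldots,v_d \in \mathbb{Z}^d$, define the finite abelian group $$\Lambda_\Delta = \{(\lambda_0,\ldots,\lambda_d) \in (\mathbb{R}/\mathbb{Z})^{d+1} : \textstyle\sum_{i=0}^d \lambda_i (v_i,1) \in \mathbb{Z}^{d+1}\}$$ with componentwise addition (its order is $\mathrm{Vol}(\Delta)$). Two $d$-dimensional lattice polytopes in $\mathbb{R}^d$ are unimodularly equivalent if one is obtained from the other by $v \mapsto vU + w$ with $U \in \mathbb{Z}^{d\times d}$, $\det U = \pm 1$, $w \in \mathbb{Z}^d$. The lattice pyramid over $\mathcal{P}\subset\mathbb{R}^{d-1}$ is $\mathrm{Pyr}(\mathcal{P}) = \mathrm{conv}(\mathcal{P}\times\{0\}, (0,\ldots,0,1)) \subset \mathbb{R}^{d}$; $\Delta$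 is called a lattice pyramid over a lower-dimensional lattice simplex if it is unimodularly equivalent to $\mathrm{Pyr}(\Delta')$ for some lattice simplex $\Delta'$ of dimension $d-1$. A $d$-dimensional lattice polytope $\mathcal{Q} \subset \mathbb{R}^d$ is reflexive if the origin is the unique lattice point in its interior and its dual polytope $\mathcal{Q}^\vee = \{y \in \mathbb{R}^d : \langle x,y\rangle \le 1 \text{ for all } x \in \mathcal{Q}\}$ is also a lattice polytope. A $d$-dimensional lattice polytope $\mathcal{P} \subset \mathbb{R}^d$ is Gorenstein of index $r$ ($r \in \mathbb{Z}_{>0}$) if there exist a reflexive polytope $\mathcal{Q} \subset \mathbb{R}^d$ and $w \in \mathbb{Z}^d$ with $\mathcal{Q} = r\mathcal{P} + w$. *)

theory Defs
  imports
    "HOL-Analysis.Analysis"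
    "HOL-Algebra.Product_Groups"
    "HOL-Algebra.Generated_Groups"
    "HOL-Computational_Algebra.Primes"
begin

text \<open>The space \<open>\<real>\<^sup>d\<close> is \<^typ>\<open>real ^ 'n\<close> with \<open>d = CARD('n)\<close>; elements are row vectors.\<close>

definition lattice_points :: "(real ^ 'n) set" where
  "lattice_points = {x. \<forall>i. x $ i \<in> \<int>}"

definition vertices :: "(real ^ 'n) set \<Rightarrow> (real ^ 'n) set" where
  "vertices P = {x. x extreme_point_of P}"

definition lattice_polytope :: "(real ^ 'n) set \<Rightarrow> bool" where
  "lattice_polytope P \<longleftrightarrow> polytope P \<and> vertices P \<subseteq> lattice_points"

definition full_lattice_polytope :: "(real ^ 'n) set \<Rightarrow> bool" where
  "full_lattice_polytope P \<longleftrightarrow> lattice_polytope P \<and> aff_dim P = int CARD('n)"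

definition normalized_volume :: "(real ^ 'n) set \<Rightarrow> real" where
  "normalized_volume P = fact CARD('n) * measure lebesgue P"

definition unimodularly_equivalent :: "(real ^ 'n) set \<Rightarrow> (real ^ 'n) set \<Rightarrow> bool" where
  "unimodularly_equivalent P Q \<longleftrightarrow>
     (\<exists>(U :: real ^ 'n ^ 'n) w. (\<forall>i j. U $ i $ j \<in> \<int>) \<and> (det U = 1 \<or> det U = -1) \<and>
        w \<in> lattice_points \<and> Q = (\<lambda>v. v v* U + w) ` P)"

text \<open>
  Since the dimension is a type, \<open>\<real>\<^sup>d\<^sup>-\<^sup>1 \<times> {0}\<close> is rendered as the coordinate hyperplane
  \<open>{x. x $ k = 0}\<close> of \<open>\<real>\<^sup>d\<close>, where the index \<open>k\<close> plays the role of the last coordinate. The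
  choice of \<open>k\<close> is immaterial up to unimodular equivalence (permute coordinates).
\<close>

definition lattice_pyramid :: "'n \<Rightarrow> (real ^ 'n) set \<Rightarrow> (real ^ 'n) set" where
  "lattice_pyramid k P = convex hull (P \<union> {axis k 1})"

definition is_lattice_pyramid :: "(real ^ 'n) set \<Rightarrow> bool" where
  "is_lattice_pyramid D \<longleftrightarrow>
     (\<exists>k D'. D' \<subseteq> {x. x $ k = 0} \<and> lattice_polytope D' \<and> (int CARD('n) - 1) simplex D' \<and>
        unimodularly_equivalent D (lattice_pyramid k D'))"

definition dual_polytope :: "(real ^ 'n) set \<Rightarrow> (real ^ 'n) set" where
  "dual_polytope Q = {y. \<forall>x\<in>Q. x \<bullet> y \<le> 1}"

definition reflexive_polytope :: "(real ^ 'n) set \<Rightarrow> bool" where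
  "reflexive_polytope Q \<longleftrightarrow> full_lattice_polytope Q \<and>
     interior Q \<inter> lattice_points = {0} \<and> lattice_polytope (dual_polytope Q)"

definition gorenstein :: "nat \<Rightarrow> (real ^ 'n) set \<Rightarrow> bool" where
  "gorenstein r P \<longleftrightarrow> r > 0 \<and> full_lattice_polytope P \<and>
     (\<exists>Q w. reflexive_polytope Q \<and> w \<in> lattice_points \<and> Q = (\<lambda>x. real r *\<^sub>R x + w) ` P)"

definition real_add_group :: "real monoid" where
  "real_add_group = \<lparr>carrier = UNIV, monoid.mult = (+), one = 0\<rparr>"

definition circle_group :: "real set monoid" where
  "circle_group = real_add_group Mod \<int>"

definition circle_class :: "real \<Rightarrow> real set" where
  "circle_class x = \<int> #>\<^bsub>real_add_group\<^esub> x"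

definition circle_power :: "nat \<Rightarrow> (nat \<Rightarrow> real set) monoid" where
  "circle_power d = product_group {..d} (\<lambda>_. circle_group)"

text \<open>
  The group \<open>\<Lambda>\<close> of the simplex with vertices \<open>v 0, \<dots>, v d\<close>, as a subset of \<open>(\<real>/\<int>)\<^sup>d\<^sup>+\<^sup>1\<close>.
  If the vertices are lattice points, the integrality condition does not depend on the
  representatives \<open>t i\<close> of the classes \<open>l i\<close>.
\<close>

definition Lambda_group :: "(nat \<Rightarrow> real ^ 'n) \<Rightarrow> (nat \<Rightarrow> real set) set" where
  "Lambda_group v =
     {l \<in> carrier (circle_power CARD('n)).
        \<exists>t :: nat \<Rightarrow> real. (\<forall>i\<le>CARD('n). l i = circle_class (t i)) \<and>
          (\<Sum>i\<le>CARD('n). t i *\<^sub>R (v i, 1 :: real)) \<in> lattice_points \<times> \<int>}"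

end

theory Submission
  imports Defs
begin

text \<open>
Write \<open>d = CARD('n)\<close> and let \<open>v 0, \<dots>, v d\<close> be the vertices of \<open>\<Delta>\<close>. The barycentric coordinates are
affine functions \<open>c i \<bullet> x + b i\<close>; homogenized, they expand \<open>(x, k)\<close> in the basis of the \<open>(v i, 1)\<close>.
The elements of \<open>\<Lambda>\<close> are the coordinate vectors of the points of \<open>\<int>\<^sup>d\<^sup>+\<^sup>1\<close>, read modulo \<open>\<int>\<close>.

Two facts come from the volume. The edge matrix of \<open>\<Delta>\<close> has determinant \<open>\<plusminus>p\<close>, so by Cramer's rule all
coordinates of lattice points lie in \<open>(1 / p) \<int>\<close> (\<open>lattice_combination_denominator\<close>). Moreover, if
\<open>(1 / p, \<dots>, 1 / p)\<close> represents an element of \<open>\<Lambda>\<close>, then it generates: exchanging one edge for the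
corresponding lattice vector turns the edges into a lattice basis
(\<open>lattice_combination_congruent\<close>). So \<open>\<Lambda>\<close> is generated by this element as soon as it contains it.

Reflexivity of \<open>Q = r \<Delta> + w\<close> can be read off the coordinates. The dual of \<open>Q\<close> is the simplex whose
vertices are gradients of the coordinates of \<open>Q\<close>, divided by minus the weights of the origin
(\<open>dual_polytope_eq\<close>, \<open>dual_vertex\<close>). That these are integral means that coordinate \<open>i\<close> of a lattice point
is always an integer multiple of \<open>m i\<close>, the coordinate of the interior lattice point \<open>(- w, r)\<close>.
So \<open>1 / m i\<close> and \<open>p * m i\<close> are positive integers with product \<open>p\<close>, and \<open>m i\<close> is \<open>1 / p\<close> or \<open>1\<close>.
The second case is where the pyramids enter: then coordinate \<open>i\<close> is integral on the lattice,
\<open>v i\<close> has lattice distance \<open>1\<close> from the opposite facet, and \<open>\<Delta>\<close> is a lattice pyramid with apex \<open>v i\<close>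
(\<open>lattice_pyramid_criterion\<close>). Hence all \<open>m i\<close> are \<open>1 / p\<close>, and their sum is both \<open>r\<close> and \<open>(d + 1) / p\<close>.
Conversely, if the uniform vector is an integral combination with \<open>d + 1 = r p\<close>, then \<open>w = - (\<Sum>v i) / p\<close>
makes \<open>r \<Delta> + w\<close> reflexive (\<open>uniform_combination_imp_gorenstein\<close>).
\<close>

section \<open>Lattice points and integral combinations\<close>

lemma lattice_points_diff: "x \<in> lattice_points \<Longrightarrow> y \<in> lattice_points \<Longrightarrow> x - y \<in> lattice_points"
  by (simp add: lattice_points_def)

lemma lattice_points_scale: "a \<in> \<int> \<Longrightarrow> x \<in> lattice_points \<Longrightarrow> a *\<^sub>R x \<in> lattice_points"
  by (simp add: lattice_points_def)

lemma lattice_points_sum: "(\<And>i. i \<in> I \<Longrightarrow> f i \<in> lattice_points) \<Longrightarrow> sum f I \<in> lattice_points"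
  by (auto simp: lattice_points_def intro: Ints_sum)

lemma inner_integral:
  assumes "x \<in> lattice_points" "y \<in> lattice_points"
  shows "x \<bullet> y \<in> \<int>"
  using assms by (auto simp: inner_vec_def lattice_points_def intro!: Ints_sum)

text \<open>
The condition that cuts out \<open>\<Lambda>\<close>, read on real representatives of the classes.
\<close>

definition lattice_combination :: "(nat \<Rightarrow> real ^ 'n) \<Rightarrow> (nat \<Rightarrow> real) \<Rightarrow> bool" where
  "lattice_combination v t \<longleftrightarrow>
     (\<Sum>i\<le>CARD('n). t i *\<^sub>R v i) \<in> lattice_points \<and> (\<Sum>i\<le>CARD('n). t i) \<in> \<int>"

lemma exists_other_index: "\<exists>j\<le>CARD('n :: finite). j \<noteq> i"
  by (metis finite_UNIV_card_ge_0 finite le0 less_numeral_extra(3) order_refl)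

lemma sum_atMost_eq_first_plus:
  fixes f :: "nat \<Rightarrow> 'a :: comm_monoid_add"
  shows "(\<Sum>i\<le>d. f i) = f 0 + (\<Sum>i\<in>{1..d}. f i)"
proof -
  have "{..d} = insert 0 {1..d}" by auto
  then show ?thesis by simp
qed

section \<open>Integrality from Cramer's rule\<close>

lemma det_integral:
  fixes A :: "real ^ 'n ^ 'n"
  assumes "\<And>i j. A $ i $ j \<in> \<int>"
  shows "det A \<in> \<int>"
  unfolding det_def using assms
  by (intro Ints_sum Ints_mult Ints_prod Ints_of_int) auto

text \<open>
By Cramer's rule the product is the determinant of an integer matrix, namely of \<open>A\<close> with its
column \<open>k\<close> replaced by the integer vector \<open>A *v x\<close>.
\<close>

lemma cramer_integral:
  fixes A :: "real ^ 'n ^ 'n"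
  assumes A: "\<And>i j. A $ i $ j \<in> \<int>" and x: "A *v x \<in> lattice_points"
  shows "x $ k * det A \<in> \<int>"
proof -
  have "det ((\<chi> i j. if j = k then (A *v x) $ i else A $ i $ j) :: real ^ 'n ^ 'n) \<in> \<int>"
    by (rule det_integral) (use A x in \<open>auto simp: lattice_points_def\<close>)
  then show ?thesis
    by (simp add: cramer_lemma)
qed

text \<open>
Suppose that the columns of \<open>A\<close> span a sublattice of index \<open>p\<close> and that their sum is \<open>p\<close> times a
lattice vector \<open>g\<close>. Replacing column \<open>k\<close> by \<open>g\<close> divides the determinant by \<open>p\<close>, so the new
columns form a lattice basis. The coordinates of \<open>A *v x\<close> in this basis are therefore integers;
at each \<open>j \<noteq> k\<close> the coordinate is \<open>x $ j - x $ k\<close>. In group terms: the finite group of fractional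
combinations has order \<open>p\<close>, so it is generated by the uniform one.
\<close>

lemma cramer_refined:
  fixes A :: "real ^ 'n ^ 'n" and p :: real
  assumes A: "\<And>i j. A $ i $ j \<in> \<int>" and p: "\<bar>det A\<bar> = p" "p \<noteq> 0"
    and g: "A *v (\<chi> i. 1 / p) \<in> lattice_points" and x: "A *v x \<in> lattice_points"
  shows "x $ j - x $ k \<in> \<int>"
proof (cases "j = k")
  case False
  define B :: "real ^ 'n ^ 'n"
    where "B = (\<chi> i j. if j = k then (A *v (\<chi> i. 1 / p)) $ i else A $ i $ j)"
  have B: "B $ i $ j \<in> \<int>" for i j
    using A g by (auto simp: B_def lattice_points_def)
  have "det B = (1 / p) * det A"
    unfolding B_def by (subst cramer_lemma) simp
  then have "\<bar>det B\<bar> = 1"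
    using p by (auto simp: abs_mult)
  \<comment> \<open>\<open>y\<close> holds the coordinates of \<open>A *v x\<close> in the basis \<open>B\<close>: subtract \<open>p * x $ k\<close> times the new column,
     which takes \<open>x $ k\<close> off every coordinate and so frees column \<open>k\<close>.\<close>
  define y :: "real ^ 'n" where "y = (\<chi> i. if i = k then p * x $ k else x $ i - x $ k)"
  have "(B *v y) $ i = (A *v x) $ i" for i
  proof -
    have "(B *v y) $ i = (\<Sum>j\<in>UNIV. B $ i $ j * y $ j)"
      by (simp add: matrix_vector_mult_def)
    also have "\<dots> = B $ i $ k * y $ k + (\<Sum>j\<in>UNIV - {k}. B $ i $ j * y $ j)"
      by (rule sum.remove) auto
    also have "(\<Sum>j\<in>UNIV - {k}. B $ i $ j * y $ j) = (\<Sum>j\<in>UNIV - {k}. A $ i $ j * (x $ j - x $ k))"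
      by (rule sum.cong) (auto simp: B_def y_def)
    also have "\<dots> = (\<Sum>j\<in>UNIV. A $ i $ j * (x $ j - x $ k))"
      by (rule sum.mono_neutral_left) auto
    also have "B $ i $ k * y $ k = (\<Sum>j\<in>UNIV. A $ i $ j * x $ k)"
      using p by (simp add: B_def y_def matrix_vector_mult_def sum_distrib_right sum_distrib_left)
    also have "(\<Sum>j\<in>UNIV. A $ i $ j * x $ k) + (\<Sum>j\<in>UNIV. A $ i $ j * (x $ j - x $ k))
      = (\<Sum>j\<in>UNIV. A $ i $ j * x $ j)"
      by (simp add: sum.distrib [symmetric] algebra_simps)
    finally show ?thesis
      by (simp add: matrix_vector_mult_def)
  qed
  then have "B *v y \<in> lattice_points"
    using x by (simp add: vec_eq_iff lattice_points_def)
  then have "y $ j * det B \<in> \<int>"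
    by (rule cramer_integral [OF B])
  then have "y $ j \<in> \<int>"
    using \<open>\<bar>det B\<bar> = 1\<close> by (auto simp: abs_if split: if_splits)
  then show ?thesis
    using False by (simp add: y_def)
qed auto

section \<open>Volume and relabelling of coordinates\<close>

text \<open>
The volume of a simplex is a determinant by \<open>content_simplex\<close>, which concerns spaces whose
coordinates are indexed by a well-order. A copy of \<open>'n\<close> carries such an order, transported along
an injection into the naturals. Relabelling coordinates is a linear bijection that preserves
lattice points and volume, so statements about volume pass to \<open>real ^ 'n\<close>.
\<close>

typedef (overloaded) 'n ordered_index = "UNIV :: 'n set" by auto

instance ordered_index :: (finite) finite
proof
  have "range (Abs_ordered_index :: 'a \<Rightarrow> _) = UNIV"
    by (metis Rep_ordered_index_inverse surj_def)
  then show "finite (UNIV :: 'a ordered_index set)"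
    by (metis finite finite_imageI)
qed

instantiation ordered_index :: (finite) wellorder
begin

definition less_eq_ordered_index :: "'a ordered_index \<Rightarrow> 'a ordered_index \<Rightarrow> bool"
  where "x \<le> y \<longleftrightarrow> to_nat (Rep_ordered_index x) \<le> to_nat (Rep_ordered_index y)"

definition less_ordered_index :: "'a ordered_index \<Rightarrow> 'a ordered_index \<Rightarrow> bool"
  where "x < y \<longleftrightarrow> to_nat (Rep_ordered_index x) < to_nat (Rep_ordered_index y)"

instance
proof
  fix P :: "'a ordered_index \<Rightarrow> bool" and a
  assume step: "\<And>x. (\<And>y. y < x \<Longrightarrow> P y) \<Longrightarrow> P x"
  show "P a"
    by (induction a rule: measure_induct_rule [of "\<lambda>x. to_nat (Rep_ordered_index x)"])
      (auto intro: step simp: less_ordered_index_def)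
qed (auto simp: less_eq_ordered_index_def less_ordered_index_def Rep_ordered_index_inject)

end

lemma bij_Rep_ordered_index: "bij Rep_ordered_index"
  by (rule bijI') (auto simp: Rep_ordered_index_inject intro: Abs_ordered_index_inverse [symmetric])

lemma CARD_ordered_index: "CARD('n ordered_index) = CARD('n)"
  using bij_Rep_ordered_index by (metis bij_betw_same_card)

definition reindex :: "real ^ 'n \<Rightarrow> real ^ 'n ordered_index"
  where "reindex x = (\<chi> i. x $ Rep_ordered_index i)"

definition unindex :: "real ^ 'n ordered_index \<Rightarrow> real ^ 'n"
  where "unindex x = (\<chi> i. x $ Abs_ordered_index i)"

lemma unindex_reindex: "unindex (reindex x) = x"
  by (simp add: reindex_def unindex_def vec_eq_iff Abs_ordered_index_inverse)

lemma reindex_unindex: "reindex (unindex x) = x"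
  by (simp add: reindex_def unindex_def vec_eq_iff Rep_ordered_index_inverse)

lemma linear_reindex: "linear reindex"
  by (rule linearI) (simp_all add: reindex_def vec_eq_iff)

lemma linear_unindex: "linear unindex"
  by (rule linearI) (simp_all add: unindex_def vec_eq_iff)

lemma reindex_lattice_points: "reindex x \<in> lattice_points \<longleftrightarrow> x \<in> lattice_points"
  by (auto simp: reindex_def lattice_points_def) (metis UNIV_I Abs_ordered_index_inverse)

lemma prod_Basis_vec: "(\<Prod>b\<in>(Basis :: (real ^ 'n) set). f b) = (\<Prod>i\<in>UNIV. f (axis i 1))"
proof -
  have "(Basis :: (real ^ 'n) set) = range (\<lambda>i. axis i 1)"
    by (auto simp: Basis_vec_def)
  then have "(\<Prod>b\<in>(Basis :: (real ^ 'n) set). f b) = prod f (range (\<lambda>i. axis i 1))"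
    by (rule arg_cong)
  also have "\<dots> = (\<Prod>i\<in>UNIV. f (axis i 1))"
    by (subst prod.reindex) (auto simp: inj_on_def axis_eq_axis)
  finally show ?thesis .
qed

lemma lborel_distr_unindex: 
  "(lborel :: (real ^ 'n) measure) = distr lborel borel (unindex :: real ^ 'n ordered_index \<Rightarrow> _)"
proof (rule lborel_eqI)
  have cont: "continuous_on UNIV (unindex :: real ^ 'n ordered_index \<Rightarrow> _)"
    by (simp add: linear_continuous_on linear_linear linear_unindex)
  have meas: "(unindex :: real ^ 'n ordered_index \<Rightarrow> _) \<in> borel_measurable borel"
    by (rule borel_measurable_continuous_onI [OF cont])
  fix l u :: "real ^ 'n"
  assume lu: "\<And>b. b \<in> Basis \<Longrightarrow> l \<bullet> b \<le> u \<bullet> b"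
  have lu': "l $ k \<le> u $ k" for k
    using lu [of "axis k 1"] by (simp add: inner_axis)
  have "unindex -` box l u = box (reindex l) (reindex u)"
    by (auto simp: mem_box_cart reindex_def unindex_def)
      (metis UNIV_I Abs_ordered_index_inverse Rep_ordered_index_inverse)+
  then have "emeasure (distr lborel borel unindex) (box l u)
      = emeasure lborel (box (reindex l) (reindex u))"
    using meas by (subst emeasure_distr) auto
  also have "\<dots> = (\<Prod>b\<in>Basis. (reindex u - reindex l) \<bullet> b)"
    using lu' by (intro emeasure_lborel_box) (auto simp: Basis_vec_def reindex_def inner_axis)
  also have "(\<Prod>b\<in>Basis. (reindex u - reindex l) \<bullet> b)
      = (\<Prod>i\<in>UNIV. u $ Rep_ordered_index i - l $ Rep_ordered_index i)"
    by (simp add: prod_Basis_vec inner_axis reindex_def)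
  also have "\<dots> = (\<Prod>i\<in>UNIV. u $ i - l $ i)"
    by (rule prod.reindex_bij_betw [OF bij_Rep_ordered_index])
  also have "\<dots> = (\<Prod>b\<in>Basis. (u - l) \<bullet> b)"
    by (simp add: prod_Basis_vec inner_axis)
  finally show "emeasure (distr lborel borel unindex) (box l u) = (\<Prod>b\<in>Basis. (u - l) \<bullet> b)" .
qed auto

lemma content_reindex:
  fixes S :: "(real ^ 'n) set"
  assumes "S \<in> sets borel"
  shows "measure lborel (reindex ` S) = measure lborel S"
proof -
  have cont: "continuous_on UNIV (unindex :: real ^ 'n ordered_index \<Rightarrow> _)"
    by (simp add: linear_continuous_on linear_linear linear_unindex)
  have meas: "(unindex :: real ^ 'n ordered_index \<Rightarrow> _) \<in> borel_measurable borel"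
    by (rule borel_measurable_continuous_onI [OF cont])
  have "measure lborel S = measure (distr lborel borel unindex) S"
    using lborel_distr_unindex by metis
  also have "\<dots> = measure lborel (unindex -` S)"
    using assms meas by (subst measure_distr) auto
  also have "unindex -` S = reindex ` S"
    using reindex_unindex [symmetric] by (auto simp: image_iff unindex_reindex intro!: bexI [of _ "unindex _"])
  finally show ?thesis by simp
qed

section \<open>Lattice simplices of given volume\<close>

text \<open>
Taking the edges at \<open>v 0\<close> as columns gives an integer matrix whose determinant is, up to sign, the
normalized volume. Since \<open>\<Sum>t\<^sub>i v\<^sub>i = \<Sum>t\<^sub>i (v\<^sub>i - v\<^sub>0) + (\<Sum>t\<^sub>i) v\<^sub>0\<close>, integrality of a combination of the
vertices becomes integrality of a matrix-vector product.
\<close>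

lemma lattice_simplex_edge_matrix:
  fixes v :: "nat \<Rightarrow> real ^ 'n"
  assumes inj: "inj_on v {..CARD('n)}" and lat: "\<And>i. i \<le> CARD('n) \<Longrightarrow> v i \<in> lattice_points"
    and vol: "fact CARD('n) * measure lborel (convex hull (v ` {..CARD('n)})) = p"
  obtains A :: "real ^ 'n ordered_index ^ 'n ordered_index" and \<sigma> :: "'n ordered_index \<Rightarrow> nat"
  where "bij_betw \<sigma> UNIV {1..CARD('n)}" "\<And>i j. A $ i $ j \<in> \<int>" "\<bar>det A\<bar> = p"
    "\<And>t x. (\<Sum>i\<le>CARD('n). t i *\<^sub>R v i) = x \<Longrightarrow>
       A *v (\<chi> j. t (\<sigma> j)) = reindex (x - (\<Sum>i\<le>CARD('n). t i) *\<^sub>R v 0)"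
proof -
  let ?d = "CARD('n)"
  obtain \<sigma> :: "'n ordered_index \<Rightarrow> nat" where \<sigma>: "bij_betw \<sigma> UNIV {1..?d}"
    using finite_same_card_bij [of "UNIV :: 'n ordered_index set" "{1..?d}"]
    by (auto simp: CARD_ordered_index)
  let ?v = "\<lambda>i. reindex (v i)"
  let ?X = "?v ` {..?d}"
  have injv: "inj_on ?v {..?d}"
    using inj by (auto simp: inj_on_def dest!: arg_cong [where f = unindex] simp: unindex_reindex)
  define A :: "real ^ 'n ordered_index ^ 'n ordered_index"
    where "A = (\<chi> i. \<chi> j. ?v (\<sigma> j) $ i - ?v 0 $ i)"
  have bij: "bij_betw (\<lambda>j. ?v (\<sigma> j)) UNIV (?X - {?v 0})"
  proof -
    have "?X - {?v 0} = ?v ` {1..?d}"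
    proof -
      have "?v ` {1..?d} = ?v ` ({..?d} - {0})"
        by (rule arg_cong [where f = "image ?v"]) auto
      also have "\<dots> = ?X - ?v ` {0}"
        by (rule inj_on_image_set_diff [OF injv]) auto
      finally show ?thesis by simp
    qed
    moreover have "bij_betw ?v {1..?d} (?v ` {1..?d})"
      using injv by (auto simp: bij_betw_def intro: inj_on_subset)
    ultimately show ?thesis
      using bij_betw_trans [OF \<sigma>] by (auto simp: o_def)
  qed
  have "measure lborel (convex hull ?X) = \<bar>det A\<bar> / fact CARD('n ordered_index)"
    unfolding A_def
  proof (rule content_simplex [where ?x0.0 = "?v 0" and f = "\<lambda>j. ?v (\<sigma> j)"])
    show "card ?X = Suc CARD('n ordered_index)"
      by (subst card_image [OF injv]) (simp add: CARD_ordered_index)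
  qed (use bij in simp_all)
  moreover have "measure lborel (convex hull ?X) = measure lborel (convex hull (v ` {..?d}))"
  proof -
    have "convex hull ?X = reindex ` (convex hull (v ` {..?d}))"
      by (simp add: convex_hull_linear_image [OF linear_reindex] image_image)
    moreover have "convex hull (v ` {..?d}) \<in> sets borel"
      by (intro borel_compact finite_imp_compact_convex_hull) auto
    ultimately show ?thesis
      by (simp add: content_reindex)
  qed
  ultimately have det: "\<bar>det A\<bar> = p"
    using vol by (simp add: CARD_ordered_index)
  have int: "A $ i $ j \<in> \<int>" for i j
  proof -
    have "\<sigma> j \<le> ?d"
      using \<sigma> by (auto simp: bij_betw_def)
    then show ?thesis
      using lat [of "\<sigma> j"] lat [of 0] by (auto simp: A_def reindex_def lattice_points_def)
  qed
  have "A *v (\<chi> j. t (\<sigma> j)) = reindex (x - (\<Sum>i\<le>?d. t i) *\<^sub>R v 0)"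
    if x: "(\<Sum>i\<le>?d. t i *\<^sub>R v i) = x" for t x
  proof -
    have "(A *v (\<chi> j. t (\<sigma> j))) $ i = reindex (x - (\<Sum>i\<le>?d. t i) *\<^sub>R v 0) $ i" for i
    proof -
      let ?i = "Rep_ordered_index i"
      have "(A *v (\<chi> j. t (\<sigma> j))) $ i = (\<Sum>j\<in>UNIV. t (\<sigma> j) * (v (\<sigma> j) $ ?i - v 0 $ ?i))"
        by (simp add: A_def matrix_vector_mult_def reindex_def mult.commute)
      also have "\<dots> = (\<Sum>j\<in>{1..?d}. t j * (v j $ ?i - v 0 $ ?i))"
        by (rule sum.reindex_bij_betw [OF \<sigma>])
      also have "\<dots> = (\<Sum>j\<le>?d. t j * (v j $ ?i - v 0 $ ?i))"
        by (simp add: sum_atMost_eq_first_plus)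
      also have "\<dots> = reindex (x - (\<Sum>i\<le>?d. t i) *\<^sub>R v 0) $ i"
        unfolding x [symmetric]
        by (simp add: reindex_def sum_subtractf algebra_simps sum_distrib_left sum_distrib_right)
      finally show ?thesis .
    qed
    then show ?thesis by (simp add: vec_eq_iff)
  qed
  with \<sigma> int det show thesis by (rule that)
qed

text \<open>
This is Lagrange's theorem for \<open>\<Lambda>\<close>, a group whose order is the normalized volume. Cramer's rule
replaces the computation of the order: it gives all coefficients but that of the base vertex \<open>v 0\<close>,
which is determined by the integrality of the sum of all coefficients.
\<close>

lemma lattice_combination_denominator:
  fixes v :: "nat \<Rightarrow> real ^ 'n"
  assumes inj: "inj_on v {..CARD('n)}" and lat: "\<And>i. i \<le> CARD('n) \<Longrightarrow> v i \<in> lattice_points"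
    and vol: "fact CARD('n) * measure lborel (convex hull (v ` {..CARD('n)})) = p" and p: "p \<in> \<int>"
    and t: "lattice_combination v t"
    and i: "i \<le> CARD('n)"
  shows "p * t i \<in> \<int>"
proof -
  from t have x: "(\<Sum>i\<le>CARD('n). t i *\<^sub>R v i) \<in> lattice_points" and k: "(\<Sum>i\<le>CARD('n). t i) \<in> \<int>"
    by (simp_all add: lattice_combination_def)
  obtain A :: "real ^ 'n ordered_index ^ 'n ordered_index" and \<sigma>
    where \<sigma>: "bij_betw \<sigma> UNIV {1..CARD('n)}" and A: "\<And>i j. A $ i $ j \<in> \<int>" "\<bar>det A\<bar> = p"
    and At: "\<And>t x. (\<Sum>i\<le>CARD('n). t i *\<^sub>R v i) = x \<Longrightarrow>
       A *v (\<chi> j. t (\<sigma> j)) = reindex (x - (\<Sum>i\<le>CARD('n). t i) *\<^sub>R v 0)"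
    by (rule lattice_simplex_edge_matrix [OF inj lat vol]) (assumption, rule that, assumption+)
  have "A *v (\<chi> j. t (\<sigma> j)) \<in> lattice_points"
    unfolding At [OF refl] reindex_lattice_points
    using x k lat by (intro lattice_points_diff lattice_points_scale) auto
  then have "t (\<sigma> j) * det A \<in> \<int>" for j
    using cramer_integral [OF A(1), of "\<chi> j. t (\<sigma> j)" j] by simp
  then have *: "p * t (\<sigma> j) \<in> \<int>" for j
    using A(2) by (auto simp: abs_if mult.commute split: if_splits)
  have pos: "p * t i \<in> \<int>" if "i \<in> {1..CARD('n)}" for i
  proof -
    from that \<sigma> obtain j where "i = \<sigma> j"
      unfolding bij_betw_def by blast
    then show ?thesis by (simp add: *)
  qed
  have "p * t 0 = p * (\<Sum>i\<le>CARD('n). t i) - (\<Sum>i\<in>{1..CARD('n)}. p * t i)"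
    by (simp add: sum_atMost_eq_first_plus sum_distrib_left distrib_left)
  also have "\<dots> \<in> \<int>"
    by (rule Ints_diff [OF Ints_mult [OF p k] Ints_sum]) (rule pos)
  finally show ?thesis
    using pos [of i] i by (cases "i = 0") auto
qed

text \<open>
Again \<open>cramer_refined\<close> compares all coefficients except the one of the base vertex \<open>v 0\<close>. For that
one, write \<open>\<Sum>t\<^sub>i \<equiv> (t\<^sub>0 - t\<^sub>1) + (d + 1) t\<^sub>1\<close> modulo the integers, where
\<open>(d + 1) t\<^sub>1 = ((d + 1) / p) (p t\<^sub>1)\<close> is a product of two integers.
\<close>

lemma lattice_combination_congruent:
  fixes v :: "nat \<Rightarrow> real ^ 'n"
  assumes inj: "inj_on v {..CARD('n)}" and lat: "\<And>i. i \<le> CARD('n) \<Longrightarrow> v i \<in> lattice_points"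
    and vol: "fact CARD('n) * measure lborel (convex hull (v ` {..CARD('n)})) = p" and p: "p \<in> \<int>" "p \<noteq> 0"
    and g: "lattice_combination v (\<lambda>i. 1 / p)"
    and t: "lattice_combination v t"
    and i: "i \<le> CARD('n)"
  shows "t i - t 0 \<in> \<int>"
proof -
  from t have k: "(\<Sum>i\<le>CARD('n). t i) \<in> \<int>"
    by (simp add: lattice_combination_def)
  from g have gk: "(\<Sum>i\<le>CARD('n). 1 / p) \<in> \<int>"
    unfolding lattice_combination_def by blast
  obtain A :: "real ^ 'n ordered_index ^ 'n ordered_index" and \<sigma>
    where \<sigma>: "bij_betw \<sigma> UNIV {1..CARD('n)}" and A: "\<And>i j. A $ i $ j \<in> \<int>" "\<bar>det A\<bar> = p"
    and At: "\<And>t x. (\<Sum>i\<le>CARD('n). t i *\<^sub>R v i) = x \<Longrightarrow>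
       A *v (\<chi> j. t (\<sigma> j)) = reindex (x - (\<Sum>i\<le>CARD('n). t i) *\<^sub>R v 0)"
    by (rule lattice_simplex_edge_matrix [OF inj lat vol]) (assumption, rule that, assumption+)
  have lattice: "A *v (\<chi> j. s (\<sigma> j)) \<in> lattice_points"
    if "lattice_combination v s" for s
    unfolding At [OF refl] reindex_lattice_points using that lat
    by (intro lattice_points_diff lattice_points_scale) (simp_all add: lattice_combination_def)
  have *: "t (\<sigma> j) - t (\<sigma> k) \<in> \<int>" for j k
    using cramer_refined [OF A p(2) _ lattice [OF t]] lattice [OF g] by simp
  then have diff: "t i - t j \<in> \<int>" if "i \<in> {1..CARD('n)}" "j \<in> {1..CARD('n)}" for i j
  proof -
    from that \<sigma> obtain j' k' where "i = \<sigma> j'" "j = \<sigma> k'"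
      unfolding bij_betw_def by blast
    then show ?thesis by (simp add: *)
  qed
  have one: "1 \<in> {1..CARD('n)}"
    by (simp add: Suc_leI)
  have "(\<Sum>i\<le>CARD('n). t i) = t 0 - t 1 + (\<Sum>i\<in>{1..CARD('n)}. t i - t 1) + real (CARD('n) + 1) * t 1"
    by (simp add: sum_atMost_eq_first_plus sum_subtractf distrib_right)
  then have "t 0 - t 1 = (\<Sum>i\<le>CARD('n). t i) - (\<Sum>i\<in>{1..CARD('n)}. t i - t 1)
      - (\<Sum>i\<le>CARD('n). 1 / p) * (p * t 1)"
    using p by (simp add: field_simps)
  also have "\<dots> \<in> \<int>"
    using diff one lattice_combination_denominator [OF inj lat vol p(1) t, of 1]
    by (intro Ints_diff [OF Ints_diff [OF k Ints_sum] Ints_mult [OF gk]]) auto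
  finally have "t 0 - t 1 \<in> \<int>" .
  moreover from this have "t i - t 1 \<in> \<int>"
    using diff [of i 1] one i by (cases "i = 0") auto
  ultimately have "t i - t 1 - (t 0 - t 1) \<in> \<int>"
    using Ints_diff by blast
  then show ?thesis by simp
qed

section \<open>Barycentric coordinates and the dual simplex\<close>

lemma interior_INT_finite:
  "finite I \<Longrightarrow> interior (\<Inter>i\<in>I. S i) = (\<Inter>i\<in>I. interior (S i))"
  by (induction I rule: finite_induct) auto

text \<open>
The affine function \<open>x \<mapsto> c i \<bullet> x + b i\<close> is the barycentric coordinate of \<open>x\<close> at the vertex \<open>v i\<close>.
For \<open>x\<close> and a weight \<open>k\<close>, the homogeneous version \<open>c i \<bullet> x + k * b i\<close> is the coefficient of
\<open>(v i, 1)\<close> in the expansion of \<open>(x, k)\<close> (\<open>coord_unique\<close>); its values at lattice points are the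
representatives of the elements of \<open>\<Lambda>\<close>.
\<close>

locale barycentric =
  fixes v :: "nat \<Rightarrow> real ^ 'n" and c :: "nat \<Rightarrow> real ^ 'n" and b :: "nat \<Rightarrow> real"
  assumes delta: "i \<le> CARD('n) \<Longrightarrow> j \<le> CARD('n) \<Longrightarrow> c i \<bullet> v j + b i = (if i = j then 1 else 0)"
    and coord_comb: "(\<Sum>i\<le>CARD('n). (c i \<bullet> x + b i) *\<^sub>R v i) = x"
    and coord_sum: "(\<Sum>i\<le>CARD('n). c i \<bullet> x + b i) = 1"
begin

lemma b_comb: "(\<Sum>i\<le>CARD('n). b i *\<^sub>R v i) = 0"
  using coord_comb [of 0] by simp

lemma b_sum: "(\<Sum>i\<le>CARD('n). b i) = 1"
  using coord_sum [of 0] by simp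

lemma c_comb: "(\<Sum>i\<le>CARD('n). (c i \<bullet> x) *\<^sub>R v i) = x"
  using coord_comb [of x] b_comb by (simp add: scaleR_left_distrib sum.distrib)

lemma c_sum: "(\<Sum>i\<le>CARD('n). c i \<bullet> x) = 0"
  using coord_sum [of x] b_sum by (simp add: sum.distrib)

lemma coord_unique:
  assumes "(\<Sum>i\<le>CARD('n). t i *\<^sub>R v i) = x" "(\<Sum>i\<le>CARD('n). t i) = k" "i \<le> CARD('n)"
  shows "t i = c i \<bullet> x + k * b i"
proof -
  have "c i \<bullet> x + k * b i = (\<Sum>j\<le>CARD('n). t j * (c i \<bullet> v j + b i))"
    unfolding assms(1,2) [symmetric]
    by (simp add: inner_sum_right sum_distrib_right sum.distrib distrib_left)
  also have "\<dots> = (\<Sum>j\<le>CARD('n). if i = j then t j else 0)"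
    by (rule sum.cong) (auto simp: delta assms(3))
  also have "\<dots> = t i"
    using assms(3) by simp
  finally show ?thesis by simp
qed

lemma halfspace_eq: "{x. c i \<bullet> x \<ge> - b i} = {x. 0 \<le> c i \<bullet> x + b i}"
  by (rule Collect_cong) linarith

lemma convex_hull_eq:
  "convex hull (v ` {..CARD('n)}) = {x. \<forall>i\<le>CARD('n). 0 \<le> c i \<bullet> x + b i}"
proof
  have "{x. \<forall>i\<le>CARD('n). 0 \<le> c i \<bullet> x + b i} = (\<Inter>i\<in>{..CARD('n)}. {x. c i \<bullet> x \<ge> - b i})"
    by (auto simp: halfspace_eq)
  then have "convex {x. \<forall>i\<le>CARD('n). 0 \<le> c i \<bullet> x + b i}"
    by (auto intro: convex_INT convex_halfspace_ge)
  then show "convex hull (v ` {..CARD('n)}) \<subseteq> {x. \<forall>i\<le>CARD('n). 0 \<le> c i \<bullet> x + b i}"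
    by (intro hull_minimal) (auto simp: delta)
next
  show "{x. \<forall>i\<le>CARD('n). 0 \<le> c i \<bullet> x + b i} \<subseteq> convex hull (v ` {..CARD('n)})"
  proof
    fix x assume x: "x \<in> {x. \<forall>i\<le>CARD('n). 0 \<le> c i \<bullet> x + b i}"
    have "(\<Sum>i\<le>CARD('n). (c i \<bullet> x + b i) *\<^sub>R v i) \<in> convex hull (v ` {..CARD('n)})"
      by (rule convex_sum) (use x coord_sum in \<open>auto intro: hull_inc\<close>)
    then show "x \<in> convex hull (v ` {..CARD('n)})"
      by (simp add: coord_comb)
  qed
qed

lemma c_nonzero:
  assumes "i \<le> CARD('n)"
  shows "c i \<noteq> 0"
proof
  assume "c i = 0"
  obtain j where "j \<le> CARD('n)" "j \<noteq> i"
    using exists_other_index by blast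
  then show False
    using delta [of i i] delta [of i j] assms \<open>c i = 0\<close> by auto
qed

lemma interior_eq:
  "interior (convex hull (v ` {..CARD('n)})) = {x. \<forall>i\<le>CARD('n). 0 < c i \<bullet> x + b i}"
proof -
  have "convex hull (v ` {..CARD('n)}) = (\<Inter>i\<in>{..CARD('n)}. {x. c i \<bullet> x \<ge> - b i})"
    by (auto simp: convex_hull_eq halfspace_eq)
  then have "interior (convex hull (v ` {..CARD('n)}))
      = (\<Inter>i\<in>{..CARD('n)}. interior {x. c i \<bullet> x \<ge> - b i})"
    by (simp add: interior_INT_finite)
  also have "\<dots> = {x. \<forall>i\<le>CARD('n). 0 < c i \<bullet> x + b i}"
  proof -
    have "interior {x. c i \<bullet> x \<ge> - b i} = {x. 0 < c i \<bullet> x + b i}" if "i \<le> CARD('n)" for i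
    proof -
      have "interior {x. c i \<bullet> x \<ge> - b i} = {x. c i \<bullet> x > - b i}"
        using c_nonzero [OF that] by (rule interior_halfspace_ge)
      also have "\<dots> = {x. 0 < c i \<bullet> x + b i}"
        by (rule Collect_cong) linarith
      finally show ?thesis .
    qed
    then show ?thesis by auto
  qed
  finally show ?thesis .
qed

lemma inner_vertices_zero:
  assumes "\<And>j. j \<le> CARD('n) \<Longrightarrow> v j \<bullet> z = 0"
  shows "z = 0"
proof -
  have "z \<bullet> z = (\<Sum>i\<le>CARD('n). (c i \<bullet> z) *\<^sub>R v i) \<bullet> z"
    by (simp only: c_comb)
  also have "\<dots> = 0"
    by (simp add: inner_sum_left assms)
  finally show ?thesis by simp
qed

text \<open>
If the origin is an interior point, the facet opposite \<open>v i\<close> lies in the hyperplane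
\<open>- (1 / b i) *\<^sub>R c i \<bullet> x = 1\<close>, so \<open>- (1 / b i) *\<^sub>R c i\<close> is the vertex of the dual simplex that belongs
to this facet.
\<close>

lemma vertex_inner_dual:
  assumes "i \<le> CARD('n)" "j \<le> CARD('n)" "b i \<noteq> 0"
  shows "v j \<bullet> (- (1 / b i) *\<^sub>R c i) = 1 - (if i = j then 1 / b i else 0)"
  using delta [OF assms(1,2)] assms(3)
  by (auto simp: inner_commute [of "v j"] field_simps split: if_splits)

text \<open>
A point \<open>y\<close> of the dual is the combination of the dual vertices with weights
\<open>b i * (1 - v i \<bullet> y)\<close>. These are nonnegative since \<open>y\<close> lies in the dual, and their sum is \<open>1\<close>
because \<open>\<Sum>b i = 1\<close> and \<open>\<Sum>b i *\<^sub>R v i = 0\<close>. Both sides of the claimed identity have the same inner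
product with every \<open>v j\<close>, and the \<open>v j\<close> span.
\<close>

lemma dual_polytope_subset:
  assumes b: "\<And>i. i \<le> CARD('n) \<Longrightarrow> 0 < b i"
  shows "dual_polytope (convex hull (v ` {..CARD('n)}))
    \<subseteq> convex hull ((\<lambda>i. - (1 / b i) *\<^sub>R c i) ` {..CARD('n)})"
proof
  let ?y = "\<lambda>i. - (1 / b i) *\<^sub>R c i"
  fix y assume y: "y \<in> dual_polytope (convex hull (v ` {..CARD('n)}))"
  have y1: "v j \<bullet> y \<le> 1" if "j \<le> CARD('n)" for j
    using y that by (auto simp: dual_polytope_def intro: hull_inc)
  let ?w = "\<lambda>i. b i * (1 - v i \<bullet> y)"
  have sum1: "(\<Sum>i\<le>CARD('n). ?w i) = 1"
  proof -
    have "(\<Sum>i\<le>CARD('n). ?w i) = (\<Sum>i\<le>CARD('n). b i) - (\<Sum>i\<le>CARD('n). b i *\<^sub>R v i) \<bullet> y"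
      by (simp add: inner_sum_left right_diff_distrib sum_subtractf)
    then show ?thesis
      by (simp add: b_comb b_sum)
  qed
  have "y - (\<Sum>i\<le>CARD('n). ?w i *\<^sub>R ?y i) = 0"
  proof (rule inner_vertices_zero)
    fix j assume j: "j \<le> CARD('n)"
    have "v j \<bullet> (\<Sum>i\<le>CARD('n). ?w i *\<^sub>R ?y i)
        = (\<Sum>i\<le>CARD('n). ?w i * (1 - (if i = j then 1 / b i else 0)))"
      unfolding inner_sum_right
    proof (rule sum.cong [OF refl])
      fix i assume "i \<in> {..CARD('n)}"
      then have "v j \<bullet> ?y i = 1 - (if i = j then 1 / b i else 0)"
        using b [of i] j by (intro vertex_inner_dual) auto
      then show "v j \<bullet> (?w i *\<^sub>R ?y i) = ?w i * (1 - (if i = j then 1 / b i else 0))"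
        by (subst inner_scaleR_right) (rule arg_cong)
    qed
    also have "\<dots> = 1 - (\<Sum>i\<le>CARD('n). if i = j then ?w i / b i else 0)"
    proof -
      have "(\<Sum>i\<le>CARD('n). ?w i * (1 - (if i = j then 1 / b i else 0)))
          = (\<Sum>i\<le>CARD('n). ?w i - (if i = j then ?w i / b i else 0))"
        by (rule sum.cong) (auto simp: right_diff_distrib)
      then show ?thesis
        by (simp only: sum_subtractf sum1)
    qed
    also have "\<dots> = v j \<bullet> y"
      using j b [OF j] by simp
    finally show "v j \<bullet> (y - (\<Sum>i\<le>CARD('n). ?w i *\<^sub>R ?y i)) = 0"
      by (simp add: inner_diff_right)
  qed
  then have "y = (\<Sum>i\<le>CARD('n). ?w i *\<^sub>R ?y i)"
    by (simp only: right_minus_eq)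
  also have "\<dots> \<in> convex hull (?y ` {..CARD('n)})"
    by (rule convex_sum) (use sum1 b y1 in \<open>auto intro!: hull_inc mult_nonneg_nonneg simp: less_imp_le\<close>)
  finally show "y \<in> convex hull (?y ` {..CARD('n)})" .
qed

lemma dual_vertex_in:
  assumes b: "0 < b i" and i: "i \<le> CARD('n)"
  shows "- (1 / b i) *\<^sub>R c i \<in> dual_polytope (convex hull (v ` {..CARD('n)}))"
  using b i by (auto simp: dual_polytope_def convex_hull_eq inner_commute field_simps)

lemma convex_dual: "convex (dual_polytope Q)"
proof -
  have "dual_polytope Q = (\<Inter>x\<in>Q. {y. x \<bullet> y \<le> 1})"
    by (auto simp: dual_polytope_def)
  then show ?thesis
    by (auto intro: convex_INT convex_halfspace_le)
qed

lemma dual_polytope_eq: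
  assumes b: "\<And>i. i \<le> CARD('n) \<Longrightarrow> 0 < b i"
  shows "dual_polytope (convex hull (v ` {..CARD('n)}))
    = convex hull ((\<lambda>i. - (1 / b i) *\<^sub>R c i) ` {..CARD('n)})"
  by (intro antisym dual_polytope_subset hull_minimal convex_dual)
    (use b dual_vertex_in in auto)

text \<open>
The dual point of facet \<open>i\<close> satisfies \<open>v j \<bullet> y = 1\<close> for all \<open>j \<noteq> i\<close>. If it lay inside a segment of
the dual, these inequalities would be equalities at both ends, and \<open>\<Sum>b j *\<^sub>R v j = 0\<close> would make
the ends agree against \<open>v i\<close> as well.
\<close>

lemma dual_vertex:
  assumes b: "\<And>i. i \<le> CARD('n) \<Longrightarrow> 0 < b i" and i: "i \<le> CARD('n)"
  shows "- (1 / b i) *\<^sub>R c i \<in> vertices (dual_polytope (convex hull (v ` {..CARD('n)})))"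
    (is "?y \<in> vertices ?D")
  unfolding vertices_def mem_Collect_eq extreme_point_of_def
proof (intro conjI ballI notI)
  show "?y \<in> ?D"
    using b i by (intro dual_vertex_in)
  fix y z assume yz: "y \<in> ?D" "z \<in> ?D" and "?y \<in> open_segment y z"
  then obtain u where u: "0 < u" "u < 1" "y \<noteq> z" "?y = (1 - u) *\<^sub>R y + u *\<^sub>R z"
    by (auto simp: in_segment)
  have eq: "v j \<bullet> y = 1 \<and> v j \<bullet> z = 1" if j: "j \<le> CARD('n)" "j \<noteq> i" for j
  proof -
    have le: "v j \<bullet> y \<le> 1" "v j \<bullet> z \<le> 1"
      using yz j by (auto simp: dual_polytope_def intro: hull_inc)
    have "(1 - u) * (1 - v j \<bullet> y) + u * (1 - v j \<bullet> z) = 0"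
    proof -
      have "v j \<bullet> ((1 - u) *\<^sub>R y + u *\<^sub>R z) = 1"
        unfolding u(4) [symmetric] using vertex_inner_dual [OF i j(1)] b [OF i] j(2) by simp
      then show ?thesis
        by (simp add: inner_add_right algebra_simps)
    qed
    moreover have "0 \<le> (1 - u) * (1 - v j \<bullet> y)" "0 \<le> u * (1 - v j \<bullet> z)"
      using le u by auto
    ultimately have "(1 - u) * (1 - v j \<bullet> y) = 0" "u * (1 - v j \<bullet> z) = 0"
      by linarith+
    then show ?thesis using u by auto
  qed
  have "y - z = 0"
  proof (rule inner_vertices_zero)
    fix k assume k: "k \<le> CARD('n)"
    have "0 = (\<Sum>j\<le>CARD('n). b j *\<^sub>R v j) \<bullet> (y - z)"
      by (simp add: b_comb)
    also have "\<dots> = (\<Sum>j\<le>CARD('n). if j = i then b i * (v i \<bullet> (y - z)) else 0)"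
      unfolding inner_sum_left by (rule sum.cong) (auto simp: eq inner_diff_right right_diff_distrib)
    also have "\<dots> = b i * (v i \<bullet> (y - z))"
      using i by simp
    finally have "v i \<bullet> (y - z) = 0"
      using b [OF i] by simp
    then show "v k \<bullet> (y - z) = 0"
      using eq [of k] k by (cases "k = i") (auto simp: inner_diff_right)
  qed
  then show False using u by simp
qed

lemma barycentric_image:
  assumes "r \<noteq> 0"
  shows "barycentric (\<lambda>i. r *\<^sub>R v i + w) (\<lambda>i. (1 / r) *\<^sub>R c i) (\<lambda>i. b i - (c i \<bullet> w) / r)"
proof
  fix i j assume ij: "i \<le> CARD('n)" "j \<le> CARD('n)"
  show "(1 / r) *\<^sub>R c i \<bullet> (r *\<^sub>R v j + w) + (b i - c i \<bullet> w / r) = (if i = j then 1 else 0)"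
  proof -
    have "(1 / r) *\<^sub>R c i \<bullet> (r *\<^sub>R v j + w) + (b i - c i \<bullet> w / r) = c i \<bullet> v j + b i"
      using assms by (simp add: inner_add_right distrib_left)
    then show ?thesis
      using delta [OF ij] by simp
  qed
next
  fix x
  have *: "(1 / r) *\<^sub>R c i \<bullet> x + (b i - c i \<bullet> w / r) = c i \<bullet> ((1 / r) *\<^sub>R (x - w)) + b i" for i
    using assms by (simp add: inner_diff_right field_simps)
  show "(\<Sum>i\<le>CARD('n). (1 / r) *\<^sub>R c i \<bullet> x + (b i - c i \<bullet> w / r)) = 1"
    unfolding * by (rule coord_sum)
  have "(\<Sum>i\<le>CARD('n). s i *\<^sub>R (r *\<^sub>R v i + w))
      = r *\<^sub>R (\<Sum>i\<le>CARD('n). s i *\<^sub>R v i) + (\<Sum>i\<le>CARD('n). s i) *\<^sub>R w" for s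
    by (simp add: scaleR_right_distrib sum.distrib scaleR_sum_right scaleR_sum_left
        mult.commute)
  then have "(\<Sum>i\<le>CARD('n). (c i \<bullet> ((1 / r) *\<^sub>R (x - w)) + b i) *\<^sub>R (r *\<^sub>R v i + w))
      = r *\<^sub>R (\<Sum>i\<le>CARD('n). (c i \<bullet> ((1 / r) *\<^sub>R (x - w)) + b i) *\<^sub>R v i)
        + (\<Sum>i\<le>CARD('n). c i \<bullet> ((1 / r) *\<^sub>R (x - w)) + b i) *\<^sub>R w"
    .
  also have "\<dots> = x"
    unfolding coord_comb coord_sum using assms by simp
  finally show "(\<Sum>i\<le>CARD('n). ((1 / r) *\<^sub>R c i \<bullet> x + (b i - c i \<bullet> w / r)) *\<^sub>R (r *\<^sub>R v i + w)) = x"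
    unfolding * .
qed

end

text \<open>
Fix \<open>i\<close> and another vertex \<open>v k\<close>. The edges at \<open>v k\<close> are linearly independent, so some linear
functional is \<open>1\<close> on the edge to \<open>v i\<close> and \<open>0\<close> on the others; normalized to vanish at \<open>v k\<close> it is
the coordinate of \<open>v i\<close>. By dimension the vertices affinely span the space, so these functions
are the coefficients of every point.
\<close>

lemma affine_independent_imp_barycentric:
  fixes v :: "nat \<Rightarrow> real ^ 'n"
  assumes bij: "bij_betw v {..CARD('n)} C" and C: "\<not> affine_dependent C"
  obtains c b where "barycentric v c b"
proof -
  have inj: "inj_on v {..CARD('n)}" and image: "C = v ` {..CARD('n)}"
    using bij by (auto simp: bij_betw_def)
  have fin: "finite C" and card: "card C = Suc CARD('n)"
    using bij image by (auto simp: card_image inj)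
  have "\<exists>g a. \<forall>j\<le>CARD('n). g \<bullet> v j + a = (if i = j then 1 else (0 :: real))" if i: "i \<le> CARD('n)" for i
  proof -
    obtain k where k: "k \<le> CARD('n)" "k \<noteq> i"
      using exists_other_index by blast
    let ?B = "(\<lambda>x. - v k + x) ` (C - {v k})"
    have "independent ?B"
      using C affine_dependent_iff_dependent2 [of "v k" C] k image by auto
    then obtain f :: "real ^ 'n \<Rightarrow> real"
      where f: "linear f" "\<And>x. x \<in> ?B \<Longrightarrow> f x = (if x = - v k + v i then 1 else 0)"
      using linear_independent_extend [of ?B "\<lambda>x. if x = - v k + v i then 1 else 0"] by blast
    define g where "g = (\<Sum>b\<in>Basis. f b *\<^sub>R b)"
    have g: "g \<bullet> x = f x" for x
    proof -
      have "f x = f (\<Sum>b\<in>Basis. (x \<bullet> b) *\<^sub>R b)"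
        by (simp add: euclidean_representation)
      also have "\<dots> = (\<Sum>b\<in>Basis. (x \<bullet> b) * f b)"
        using f(1) by (simp add: linear_sum linear_scale)
      also have "\<dots> = g \<bullet> x"
        by (simp add: g_def inner_sum_left inner_commute [of x] mult.commute)
      finally show ?thesis by simp
    qed
    have "g \<bullet> v j + - (g \<bullet> v k) = (if i = j then 1 else 0)" if j: "j \<le> CARD('n)" for j
    proof (cases "j = k")
      case False
      then have "v j \<noteq> v k" "v j = v i \<longleftrightarrow> j = i"
        using inj j k i by (auto simp: inj_on_def)
      then have "f (- v k + v j) = (if i = j then 1 else 0)"
        using f(2) [of "- v k + v j"] j image by auto
      then show ?thesis
        by (simp add: g [symmetric] inner_diff_right)
    qed (use k in auto)
    then show ?thesis by blast
  qed
  then obtain c b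
    where cb: "\<And>i j. i \<le> CARD('n) \<Longrightarrow> j \<le> CARD('n) \<Longrightarrow> c i \<bullet> v j + b i = (if i = j then 1 else (0 :: real))"
    by metis
  have "(\<Sum>i\<le>CARD('n). (c i \<bullet> x + b i) *\<^sub>R v i) = x \<and> (\<Sum>i\<le>CARD('n). c i \<bullet> x + b i) = 1" for x
  proof -
    have "aff_dim C = int CARD('n)"
      using aff_dim_affine_independent [OF C] card by simp
    then have "affine hull C = UNIV"
      using aff_dim_eq_full [of C] by simp
    then have "x \<in> affine hull C" by simp
    then obtain u where u: "sum u C = 1" "(\<Sum>y\<in>C. u y *\<^sub>R y) = x"
      unfolding affine_hull_finite [OF fin] by blast
    define t where "t i = u (v i)" for i
    have t: "(\<Sum>i\<le>CARD('n). t i) = 1" "(\<Sum>i\<le>CARD('n). t i *\<^sub>R v i) = x"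
      using u by (simp_all add: image sum.reindex [OF inj] t_def)
    have "t i = c i \<bullet> x + b i" if i: "i \<le> CARD('n)" for i
    proof -
      have "c i \<bullet> x + b i = c i \<bullet> x + (\<Sum>j\<le>CARD('n). t j) * b i"
        by (simp add: t)
      also have "\<dots> = (\<Sum>j\<le>CARD('n). t j * (c i \<bullet> v j + b i))"
        unfolding t(2) [symmetric]
        by (simp add: inner_sum_right sum_distrib_right sum.distrib distrib_left)
      also have "\<dots> = (\<Sum>j\<le>CARD('n). if i = j then t j else 0)"
        by (rule sum.cong) (auto simp: cb i)
      finally show ?thesis using i by simp
    qed
    then have "(\<Sum>i\<le>CARD('n). (c i \<bullet> x + b i) *\<^sub>R v i) = (\<Sum>i\<le>CARD('n). t i *\<^sub>R v i)"
      "(\<Sum>i\<le>CARD('n). c i \<bullet> x + b i) = (\<Sum>i\<le>CARD('n). t i)"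
      by auto
    with t show ?thesis by simp
  qed
  with cb have "barycentric v c b"
    by unfold_locales auto
  then show thesis by (rule that)
qed

section \<open>Lattice pyramids\<close>

text \<open>
Euclid's algorithm on the entries of \<open>c\<close>: while two entries are nonzero, subtracting the smaller
from the larger (up to sign) lowers the sum of absolute values; the inverse row operation carries a
matrix for the reduced vector to one for \<open>c\<close>. The vector \<open>u\<close> certifies that \<open>c\<close> is primitive, and
transforms contragrediently. At the end a single entry \<open>\<plusminus>1\<close> remains.
\<close>

lemma primitive_vector_extends_to_unimodular:
  fixes c u :: "real ^ 'n"
  assumes "c \<in> lattice_points" "u \<in> lattice_points" "c \<bullet> u = 1"
  shows "\<exists>(U :: real ^ 'n ^ 'n) k. (\<forall>i j. U $ i $ j \<in> \<int>) \<and> (det U = 1 \<or> det U = -1) \<and> column k U = c"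
  using assms
proof (induction "nat \<lfloor>\<Sum>i\<in>UNIV. \<bar>c $ i\<bar>\<rfloor>" arbitrary: c u rule: less_induct)
  case less
  have cint: "c $ i \<in> \<int>" and uint: "u $ i \<in> \<int>" for i
    using less.prems by (auto simp: lattice_points_def)
  show ?case
  proof (cases "\<exists>i j. i \<noteq> j \<and> c $ j \<noteq> 0 \<and> \<bar>c $ j\<bar> \<le> \<bar>c $ i\<bar>")
    case True
    then obtain i j where ij: "i \<noteq> j" "c $ j \<noteq> 0" "\<bar>c $ j\<bar> \<le> \<bar>c $ i\<bar>"
      by blast
    define s where "s = sgn (c $ i) * sgn (c $ j)"
    have sint: "s \<in> \<int>"
      by (auto simp: s_def sgn_if)
    define c' where "c' = (\<chi> l. if l = i then c $ i - s * c $ j else c $ l)"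
    define u' where "u' = (\<chi> l. if l = j then u $ j + s * u $ i else u $ l)"
    have c'_int: "c' \<in> lattice_points" and u'_int: "u' \<in> lattice_points"
      using cint uint sint by (auto simp: lattice_points_def c'_def u'_def)
    have c'_i: "\<bar>c' $ i\<bar> = \<bar>c $ i\<bar> - \<bar>c $ j\<bar>"
      using ij by (auto simp: c'_def s_def sgn_if abs_if split: if_splits)
    have split: "sum f UNIV = f i + (f j + sum f (UNIV - {i} - {j}))" for f :: "'n \<Rightarrow> real"
      using ij sum.remove [of UNIV i f] sum.remove [of "UNIV - {i}" j f] by auto
    have rest: "(\<Sum>l\<in>UNIV - {i} - {j}. g (c' $ l) (u' $ l)) = (\<Sum>l\<in>UNIV - {i} - {j}. g (c $ l) (u $ l))"
      for g :: "real \<Rightarrow> real \<Rightarrow> real"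
      by (rule sum.cong) (auto simp: c'_def u'_def)
    have sum_c': "(\<Sum>l\<in>UNIV. \<bar>c' $ l\<bar>) = (\<Sum>l\<in>UNIV. \<bar>c $ l\<bar>) - \<bar>c $ j\<bar>"
      unfolding split [of "\<lambda>l. \<bar>c' $ l\<bar>"] split [of "\<lambda>l. \<bar>c $ l\<bar>"] rest [of "\<lambda>x y. \<bar>x\<bar>"]
      using ij c'_i by (simp add: c'_def)
    have "c' \<bullet> u' = c \<bullet> u"
      unfolding inner_vec_def split [of "\<lambda>l. c' $ l \<bullet> u' $ l"] split [of "\<lambda>l. c $ l \<bullet> u $ l"]
        rest [of "\<lambda>x y. x \<bullet> y"]
      using ij by (simp add: c'_def u'_def algebra_simps)
    then have "c' \<bullet> u' = 1"
      using less.prems by simp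
    moreover have "1 \<le> \<bar>c $ j\<bar>"
      using cint ij(2) by (rule Ints_nonzero_abs_ge1)
    then have "nat \<lfloor>\<Sum>l\<in>UNIV. \<bar>c' $ l\<bar>\<rfloor> < nat \<lfloor>\<Sum>l\<in>UNIV. \<bar>c $ l\<bar>\<rfloor>"
    proof -
      have "0 \<le> (\<Sum>l\<in>UNIV. \<bar>c' $ l\<bar>)"
        by (simp add: sum_nonneg)
      with sum_c' \<open>1 \<le> \<bar>c $ j\<bar>\<close> show ?thesis
        by linarith
    qed
    ultimately obtain U' :: "real ^ 'n ^ 'n" and k where U': "\<forall>i j. U' $ i $ j \<in> \<int>" "det U' = 1 \<or> det U' = -1" "column k U' = c'"
      using less.hyps [OF _ c'_int u'_int] by blast
    define U where "U = (\<chi> l. if l = i then row i U' + s *s row j U' else row l U')"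
    have "det U = det U'"
      unfolding U_def by (rule det_row_operation [OF ij(1)])
    moreover have "\<forall>i j. U $ i $ j \<in> \<int>"
      using U'(1) sint by (auto simp: U_def row_def)
    moreover have "column k U = c"
    proof -
      have U'k: "U' $ l $ k = c' $ l" for l
        unfolding U'(3) [symmetric] by (simp add: column_def)
      have "U $ l $ k = c $ l" for l
        using ij(1) by (simp add: U_def row_def U'k) (simp add: c'_def)
      then show ?thesis by (simp add: column_def vec_eq_iff)
    qed
    ultimately show ?thesis
      using U'(2) by (intro exI [of _ U] exI [of _ k]) simp
  next
    case False
    obtain m where m: "c $ m \<noteq> 0"
    proof -
      have "c \<noteq> 0" using less.prems(3) by auto
      then show ?thesis using that by (auto simp: vec_eq_iff)
    qed
    have zero: "c $ l = 0" if "l \<noteq> m" for l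
    proof -
      have "i \<noteq> j \<Longrightarrow> c $ j \<noteq> 0 \<Longrightarrow> \<not> \<bar>c $ j\<bar> \<le> \<bar>c $ i\<bar>" for i j
        using False by blast
      from this [of m l] this [of l m] show ?thesis
        using m that by fastforce
    qed
    have "c \<bullet> u = c $ m * u $ m"
    proof -
      have "c \<bullet> u = (\<Sum>l\<in>UNIV. if l = m then c $ m * u $ m else 0)"
        unfolding inner_vec_def
        by (rule sum.cong) (simp_all add: zero)
      then show ?thesis by simp
    qed
    then have "c $ m * u $ m = 1"
      using less.prems by simp
    then have prod: "\<bar>c $ m\<bar> * \<bar>u $ m\<bar> = 1"
      by (simp add: abs_mult [symmetric])
    have "1 \<le> \<bar>c $ m\<bar>" "1 \<le> \<bar>u $ m\<bar>"
      using \<open>c $ m * u $ m = 1\<close> by (auto intro!: Ints_nonzero_abs_ge1 cint uint)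
    with prod mult_left_mono [of 1 "\<bar>u $ m\<bar>" "\<bar>c $ m\<bar>"] have "\<bar>c $ m\<bar> = 1"
      by simp
    then have cm: "c $ m = 1 \<or> c $ m = -1"
      by linarith
    define U :: "real ^ 'n ^ 'n" where "U = (\<chi> i j. if i = j then (if i = m then c $ m else 1) else 0)"
    have "det U = (\<Prod>i\<in>UNIV. U $ i $ i)"
      by (rule det_diagonal) (simp add: U_def)
    also have "\<dots> = (\<Prod>i\<in>UNIV. if i = m then c $ m else 1)"
      by (simp add: U_def)
    also have "\<dots> = c $ m"
      by simp
    finally have "det U = c $ m" .
    moreover have "column m U = c"
      using zero by (auto simp: U_def column_def vec_eq_iff)
    moreover have "\<forall>i j. U $ i $ j \<in> \<int>"
      using cint by (auto simp: U_def)
    ultimately show ?thesis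
      using cm by (intro exI [of _ U] exI [of _ m]) simp
  qed
qed

text \<open>
An integral affine function that is \<open>1\<close> at \<open>v i\<close> and \<open>0\<close> at the other vertices puts \<open>v i\<close> at lattice
distance \<open>1\<close> from the opposite facet. Its gradient \<open>c\<close> is primitive, as \<open>c \<bullet> (v i - v j) = 1\<close>, so it
is a column of a unimodular matrix, which makes the function a coordinate of \<open>\<real>\<^sup>d\<close>.
\<close>

lemma lattice_pyramid_criterion:
  fixes v :: "nat \<Rightarrow> real ^ 'n"
  assumes indep: "\<not> affine_dependent (v ` {..CARD('n)})" and inj: "inj_on v {..CARD('n)}"
    and lat: "\<And>i. i \<le> CARD('n) \<Longrightarrow> v i \<in> lattice_points"
    and i: "i \<le> CARD('n)"
    and h: "\<And>j. j \<le> CARD('n) \<Longrightarrow> c \<bullet> v j + b = (if i = j then 1 else 0)"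
    and c: "c \<in> lattice_points" and b: "b \<in> \<int>"
  shows "is_lattice_pyramid (convex hull (v ` {..CARD('n)}))"
proof -
  obtain j where j: "j \<le> CARD('n)" "j \<noteq> i"
    using exists_other_index by blast
  have "c \<bullet> (v i - v j) = 1"
    using h [OF i] h [OF j(1)] j(2) by (simp add: inner_diff_right)
  moreover have "v i - v j \<in> lattice_points"
    using lat [OF i] lat [OF j(1)] by (auto simp: lattice_points_def)
  ultimately obtain U :: "real ^ 'n ^ 'n" and k where U: "\<forall>i j. U $ i $ j \<in> \<int>" "det U = 1 \<or> det U = -1" "column k U = c"
    using primitive_vector_extends_to_unimodular [OF c] by blast
  have Uk: "(x v* U) $ k = c \<bullet> x" for x
    unfolding U(3) [symmetric]
    by (simp add: vector_matrix_mult_def column_def inner_vec_def mult.commute)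
  have U_lat: "x v* U \<in> lattice_points" if "x \<in> lattice_points" for x
    using that U(1) by (auto simp: lattice_points_def vector_matrix_mult_def intro!: Ints_sum)
  have lin: "linear (\<lambda>x. x v* U)"
    by (rule linearI) (simp_all add: vector_matrix_mult_def vec_eq_iff sum.distrib 
        sum_distrib_left distrib_left mult_ac)
  have injU: "inj (\<lambda>x. x v* U)"
  proof -
    have "invertible U"
      using U(2) by (auto simp: invertible_det_nz)
    then obtain V where V: "U ** V = mat 1"
      by (auto simp: invertible_def)
    show ?thesis
    proof (rule inj_on_inverseI)
      fix x show "(x v* U) v* V = x"
        by (simp add: vector_matrix_mul_assoc V)
    qed
  qed
  \<comment> \<open>The translation makes coordinate \<open>k\<close> equal to \<open>c \<bullet> x + b\<close> and moves \<open>v i\<close> to \<open>axis k 1\<close>.\<close>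
  define w where "w = (\<chi> l. if l = k then b else - (v i v* U) $ l)"
  have w: "w \<in> lattice_points"
    using U_lat [OF lat [OF i]] b by (auto simp: lattice_points_def w_def)
  define \<phi> where "\<phi> x = x v* U + w" for x
  have \<phi>_i: "\<phi> (v i) = axis k 1"
    using h [OF i] by (auto simp: \<phi>_def w_def vec_eq_iff Uk axis_def)
  have \<phi>_j: "\<phi> (v j) $ k = 0" if "j \<le> CARD('n)" "j \<noteq> i" for j
    using h [OF that(1)] that(2) by (auto simp: \<phi>_def w_def Uk)
  have \<phi>_hull: "\<phi> ` (convex hull S) = convex hull (\<phi> ` S)" for S
  proof -
    have "\<phi> ` T = (\<lambda>x. w + x) ` (\<lambda>x. x v* U) ` T" for T
      by (auto simp: \<phi>_def image_image add.commute)
    then show ?thesis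
      by (simp add: convex_hull_translation convex_hull_linear_image [OF lin])
  qed
  have \<phi>_inj: "inj \<phi>"
    using injU by (auto simp: inj_def \<phi>_def)
  have \<phi>_indep: "\<not> affine_dependent (\<phi> ` S)" if S: "\<not> affine_dependent S" for S
  proof
    have fin: "finite S"
      using S by (rule aff_independent_finite)
    have inj: "inj_on \<phi> S"
      using \<phi>_inj by (rule inj_on_subset) simp
    assume "affine_dependent (\<phi> ` S)"
    then obtain a where a: "sum a (\<phi> ` S) = 0" "\<exists>y\<in>\<phi> ` S. a y \<noteq> 0" "(\<Sum>y\<in>\<phi> ` S. a y *\<^sub>R y) = 0"
      unfolding affine_dependent_explicit_finite [OF finite_imageI [OF fin]] by blast
    have sum0: "(\<Sum>x\<in>S. a (\<phi> x)) = 0"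
      using a(1) by (simp add: sum.reindex [OF inj])
    have "(\<Sum>x\<in>S. a (\<phi> x) *\<^sub>R \<phi> x)
        = (\<Sum>x\<in>S. a (\<phi> x) *\<^sub>R (x v* U)) + (\<Sum>x\<in>S. a (\<phi> x)) *\<^sub>R w"
      by (simp add: \<phi>_def scaleR_right_distrib sum.distrib scaleR_sum_left)
    also have "(\<Sum>x\<in>S. a (\<phi> x) *\<^sub>R (x v* U)) = (\<Sum>x\<in>S. a (\<phi> x) *\<^sub>R x) v* U"
      by (simp add: linear_sum [OF lin] linear_scale [OF lin])
    finally have "(\<Sum>x\<in>S. a (\<phi> x) *\<^sub>R x) v* U = 0 v* U"
      using a(3) by (simp add: sum.reindex [OF inj] sum0)
    then have "(\<Sum>x\<in>S. a (\<phi> x) *\<^sub>R x) = 0"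
      by (rule injD [OF injU])
    then have "affine_dependent S"
      unfolding affine_dependent_explicit_finite [OF fin] using sum0 a(2) by auto
    with S show False ..
  qed
  define F where "F = v ` ({..CARD('n)} - {i})"
  have F: "v ` {..CARD('n)} = insert (v i) F"
    using i by (auto simp: F_def)
  have "\<not> affine_dependent F"
    using indep by (rule affine_independent_subset) (auto simp: F_def)
  define D' where "D' = convex hull (\<phi> ` F)"
  have card: "card (\<phi> ` F) = CARD('n)"
  proof -
    have "card (\<phi> ` F) = card F"
      using \<phi>_inj by (intro card_image inj_on_subset [OF \<phi>_inj]) auto
    also have "\<dots> = card ({..CARD('n)} - {i})"
      unfolding F_def using inj by (intro card_image) (auto intro: inj_on_subset)
    also have "\<dots> = CARD('n)"
      using i by simp
    finally show ?thesis .
  qed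
  have "D' \<subseteq> {x. x $ k = 0}"
  proof -
    have "convex {x :: real ^ 'n. x $ k = 0}"
      using convex_hyperplane [of "axis k 1 :: real ^ 'n" 0] by (simp add: inner_axis' )
    then show ?thesis
      unfolding D'_def by (intro hull_minimal) (auto simp: F_def \<phi>_j)
  qed
  moreover have "lattice_polytope D'"
    unfolding lattice_polytope_def
  proof
    show "polytope D'"
      unfolding D'_def F_def by (intro polytope_convex_hull) auto
    have "vertices D' \<subseteq> \<phi> ` F"
      unfolding vertices_def D'_def by (auto dest: extreme_point_of_convex_hull)
    also have "\<dots> \<subseteq> lattice_points"
      using U_lat lat w unfolding F_def \<phi>_def by (auto simp: lattice_points_def)
    finally show "vertices D' \<subseteq> lattice_points" .
  qed
  moreover have "(int CARD('n) - 1) simplex D'"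
    unfolding simplex_def D'_def using \<phi>_indep [OF \<open>\<not> affine_dependent F\<close>] card by auto
  moreover have "unimodularly_equivalent (convex hull (v ` {..CARD('n)})) (lattice_pyramid k D')"
  proof -
    have "\<phi> ` (convex hull (v ` {..CARD('n)})) = convex hull (\<phi> ` F \<union> {axis k 1})"
      unfolding \<phi>_hull F image_insert \<phi>_i by simp
    also have "\<dots> = lattice_pyramid k D'"
      unfolding lattice_pyramid_def D'_def by (rule hull_Un_left)
    finally have "lattice_pyramid k D' = (\<lambda>v. v v* U + w) ` (convex hull (v ` {..CARD('n)}))"
      by (simp add: \<phi>_def [abs_def])
    then show ?thesis
      unfolding unimodularly_equivalent_def using U(1,2) w by blast
  qed
  ultimately show ?thesis
    unfolding is_lattice_pyramid_def by blast
qed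

section \<open>Powers of the circle group\<close>

lemma comm_group_real_add: "comm_group real_add_group"
  by (rule comm_groupI) (auto simp: real_add_group_def intro: exI [of _ "- _"])

lemma Ints_normal: "\<int> \<lhd> real_add_group"
proof -
  interpret comm_group real_add_group by (rule comm_group_real_add)
  have "inv\<^bsub>real_add_group\<^esub> x = - x" for x
    by (rule inv_equality) (auto simp: real_add_group_def)
  then have "subgroup \<int> real_add_group"
    by unfold_locales (auto simp: real_add_group_def)
  then show ?thesis by (rule subgroup_imp_normal)
qed

lemma group_circle_group: "group circle_group"
  unfolding circle_group_def by (rule normal.factorgroup_is_group [OF Ints_normal])

lemma group_circle_power: "group (circle_power d)"
  unfolding circle_power_def by (simp add: group_circle_group)

lemma circle_class_eq_iff: "circle_class x = circle_class y \<longleftrightarrow> x - y \<in> \<int>"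
proof
  have "y \<in> circle_class y"
    by (auto simp: circle_class_def r_coset_def real_add_group_def intro: bexI [of _ 0])
  moreover assume "circle_class x = circle_class y"
  ultimately have "y \<in> circle_class x" by simp
  then obtain m where "m \<in> \<int>" "y = m + x"
    unfolding circle_class_def r_coset_def real_add_group_def by fastforce
  then have "x - y = - m" by simp
  with \<open>m \<in> \<int>\<close> show "x - y \<in> \<int>" by simp
next
  assume *: "x - y \<in> \<int>"
  have "\<exists>m\<in>\<int>. n + x = m + y" if "n \<in> \<int>" for n
    by (rule bexI [of _ "n + (x - y)"]) (use * that in auto)
  moreover have "\<exists>m\<in>\<int>. n + y = m + x" if "n \<in> \<int>" for n
    by (rule bexI [of _ "n - (x - y)"]) (use * that in auto)
  ultimately show "circle_class x = circle_class y"
    by (auto simp: circle_class_def r_coset_def real_add_group_def)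
qed

lemma hom_circle_class: "circle_class \<in> hom real_add_group circle_group"
  using normal.r_coset_hom_Mod [OF Ints_normal]
  by (simp add: circle_class_def [abs_def] circle_group_def)

text \<open>
The cyclic group generated by a diagonal element consists of the images of the integer multiples of
a real number under this homomorphism.
\<close>

lemma hom_circle_class_diagonal:
  "(\<lambda>x. \<lambda>i\<in>{..d}. circle_class x) \<in> hom real_add_group (circle_power d)"
  using hom_circle_class
  by (auto simp: hom_def circle_power_def PiE_iff Pi_iff intro!: restrict_ext)

lemma real_add_group_int_pow: "x [^]\<^bsub>real_add_group\<^esub> (k :: int) = of_int k * x"
proof -
  interpret comm_group real_add_group by (rule comm_group_real_add)
  have inv: "inv\<^bsub>real_add_group\<^esub> x = - x" for x
    by (rule inv_equality) (auto simp: real_add_group_def)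
  have "x [^]\<^bsub>real_add_group\<^esub> (n :: nat) = of_nat n * x" for n
    by (induction n) (auto simp: real_add_group_def nat_pow_def algebra_simps)
  then show ?thesis
    by (simp add: int_pow_def2 inv)
qed

lemma generate_diagonal_class:
  "generate (circle_power d) {\<lambda>i\<in>{..d}. circle_class x}
    = range (\<lambda>k :: int. \<lambda>i\<in>{..d}. circle_class (of_int k * x))"
proof -
  interpret group "circle_power d" by (rule group_circle_power)
  let ?h = "\<lambda>x. \<lambda>i\<in>{..d}. circle_class x"
  have G: "group real_add_group"
    by (rule comm_group.axioms [OF comm_group_real_add])
  have carrier: "?h x \<in> carrier (circle_power d)"
    using hom_circle_class_diagonal [of d] by (auto simp: hom_def real_add_group_def)
  have "?h x [^]\<^bsub>circle_power d\<^esub> k = ?h (of_int k * x)" for k :: int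
  proof -
    have "?h (x [^]\<^bsub>real_add_group\<^esub> k) = ?h x [^]\<^bsub>circle_power d\<^esub> k"
      by (rule hom_int_pow [OF hom_circle_class_diagonal _ G group_circle_power])
        (simp add: real_add_group_def)
    then show ?thesis by (simp add: real_add_group_int_pow)
  qed
  then show ?thesis
    by (auto simp: generate_pow [OF carrier])
qed

lemma lattice_combination_iff:
  fixes v :: "nat \<Rightarrow> real ^ 'n"
  shows "(\<Sum>i\<le>CARD('n). t i *\<^sub>R (v i, 1 :: real)) \<in> lattice_points \<times> \<int> \<longleftrightarrow> lattice_combination v t"
  by (simp add: lattice_combination_def mem_Times_iff fst_sum snd_sum)

lemma circle_class_in_carrier: "circle_class x \<in> carrier circle_group"
  using hom_circle_class by (auto simp: hom_def real_add_group_def)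

lemma Lambda_group_eq:
  fixes v :: "nat \<Rightarrow> real ^ 'n"
  shows "Lambda_group v = (\<lambda>t. \<lambda>i\<in>{..CARD('n)}. circle_class (t i)) ` Collect (lattice_combination v)"
proof (intro equalityI subsetI)
  fix l assume "l \<in> Lambda_group v"
  then obtain t where l: "l \<in> carrier (circle_power CARD('n))"
    and t: "\<forall>i\<le>CARD('n). l i = circle_class (t i)" "lattice_combination v t"
    unfolding Lambda_group_def lattice_combination_iff by blast
  have "l \<in> extensional {..CARD('n)}"
    using l by (simp add: circle_power_def PiE_iff)
  then have "l = (\<lambda>i\<in>{..CARD('n)}. circle_class (t i))"
    by (rule extensionalityI [OF _ restrict_extensional]) (use t in auto)
  with t show "l \<in> (\<lambda>t. \<lambda>i\<in>{..CARD('n)}. circle_class (t i)) ` Collect (lattice_combination v)"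
    by blast
next
  fix l assume "l \<in> (\<lambda>t. \<lambda>i\<in>{..CARD('n)}. circle_class (t i)) ` Collect (lattice_combination v)"
  then obtain t where "lattice_combination v t" "l = (\<lambda>i\<in>{..CARD('n)}. circle_class (t i))"
    by blast
  moreover from this have "l \<in> carrier (circle_power CARD('n))"
    by (simp add: circle_power_def PiE_iff circle_class_in_carrier)
  ultimately show "l \<in> Lambda_group v"
    unfolding Lambda_group_def lattice_combination_iff by auto
qed

section \<open>Gorenstein simplices\<close>

text \<open>
Let \<open>Q = r \<Delta> + w\<close> be reflexive. The weights \<open>m i\<close> of the expansion of \<open>(- w, r)\<close> in the \<open>(v i, 1)\<close>
represent an element of \<open>\<Lambda>\<close>, so \<open>p * m i\<close> is an integer, and \<open>m i > 0\<close> since the origin is interior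
to \<open>Q\<close>. The dual vertex \<open>y\<close> of facet \<open>i\<close> is integral and \<open>c i = - m i *\<^sub>R y\<close>; hence every lattice point
has coordinate \<open>i\<close> in \<open>m i * \<int>\<close>. The vertex \<open>v i\<close> has coordinate \<open>1\<close>, so \<open>1 / m i\<close> is an integer
too. As \<open>p\<close> is prime, \<open>m i\<close> is \<open>1 / p\<close> or \<open>1\<close>, and \<open>m i = 1\<close> would make coordinate \<open>i\<close>
integral on the lattice.
\<close>

lemma (in barycentric) gorenstein_imp_uniform_combination:
  fixes p r :: nat
  assumes p: "prime p"
    and lat: "\<And>i. i \<le> CARD('n) \<Longrightarrow> v i \<in> lattice_points"
    and denom: "\<And>t i. lattice_combination v t \<Longrightarrow> i \<le> CARD('n) \<Longrightarrow> real p * t i \<in> \<int>"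
    and frac: "\<And>i. i \<le> CARD('n) \<Longrightarrow> c i \<notin> lattice_points \<or> b i \<notin> \<int>"
    and gor: "gorenstein r (convex hull (v ` {..CARD('n)}))"
  shows "lattice_combination v (\<lambda>i. 1 / real p) \<and> CARD('n) + 1 = r * p"
proof -
  obtain w where r: "r > 0" and w: "w \<in> lattice_points"
    and refl: "reflexive_polytope ((\<lambda>x. real r *\<^sub>R x + w) ` (convex hull (v ` {..CARD('n)})))"
    using gor by (auto simp: gorenstein_def)
  let ?v = "\<lambda>i. real r *\<^sub>R v i + w" and ?c = "\<lambda>i. (1 / real r) *\<^sub>R c i"
  let ?b = "\<lambda>i. b i - (c i \<bullet> w) / real r" and ?Q = "convex hull ((\<lambda>i. real r *\<^sub>R v i + w) ` {..CARD('n)})"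
  interpret Q: barycentric ?v ?c ?b
    using r by (intro barycentric_image) simp
  have "(\<lambda>x. real r *\<^sub>R x + w) ` (convex hull (v ` {..CARD('n)})) = ?Q"
    using convex_hull_affinity [of w "real r" "v ` {..CARD('n)}"] by (simp add: image_image add.commute)
  then have "0 \<in> interior ?Q" and dual: "vertices (dual_polytope ?Q) \<subseteq> lattice_points"
    using refl by (auto simp: reflexive_polytope_def lattice_polytope_def)
  then have pos: "0 < ?b i" if "i \<le> CARD('n)" for i
    using that Q.interior_eq by simp
  define m where "m i = real r * b i - c i \<bullet> w" for i
  have m_pos: "0 < m i" if "i \<le> CARD('n)" for i
    using pos [OF that] r by (simp add: m_def field_simps)
  have m_sum: "(\<Sum>i\<le>CARD('n). m i) = real r"
    using b_sum c_sum [of w] by (simp add: m_def sum_subtractf sum_distrib_left [symmetric])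
  have m_comb: "(\<Sum>i\<le>CARD('n). m i *\<^sub>R v i) = - w"
  proof -
    have "(\<Sum>i\<le>CARD('n). m i *\<^sub>R v i) = real r *\<^sub>R (\<Sum>i\<le>CARD('n). b i *\<^sub>R v i) - (\<Sum>i\<le>CARD('n). (c i \<bullet> w) *\<^sub>R v i)"
      by (simp add: m_def scaleR_left_diff_distrib sum_subtractf scaleR_sum_right)
    then show ?thesis by (simp add: b_comb c_comb)
  qed
  have m_lat: "lattice_combination v m"
    using w by (simp add: lattice_combination_def m_sum m_comb) (simp add: lattice_points_def)
  have m_eq: "m i = 1 / real p" if i: "i \<le> CARD('n)" for i
  proof -
    define y where "y = - (1 / m i) *\<^sub>R c i"
    have "- (1 / ?b i) *\<^sub>R ?c i = y"
      using r by (simp add: y_def m_def field_simps)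
    then have y: "y \<in> lattice_points"
      using Q.dual_vertex [OF pos i] dual by auto
    have c_y: "c i = - m i *\<^sub>R y"
      using m_pos [OF i] by (simp add: y_def)
    obtain j where j: "j \<le> CARD('n)" "j \<noteq> i"
      using exists_other_index by blast
    have b_y: "b i = m i * (y \<bullet> v j)"
      using delta [OF i j(1)] j(2) by (simp add: c_y)
    have "m i * (y \<bullet> v j - y \<bullet> v i) = 1"
      using delta [OF i i] by (simp add: c_y b_y algebra_simps)
    moreover have "y \<bullet> v j - y \<bullet> v i \<in> \<int>"
      using y lat i j by (intro Ints_diff inner_integral) auto
    ultimately obtain k :: int where k: "m i * of_int k = 1"
      by (auto elim: Ints_cases)
    obtain a :: int where a: "real p * m i = of_int a"
      using denom [OF m_lat i] by (auto elim: Ints_cases)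
    have "of_int (a * k) = (of_int (int p) :: real)"
      using k by (simp add: a [symmetric])
    then have ak: "a * k = int p"
      by (simp only: of_int_eq_iff)
    have "0 < a"
      using a m_pos [OF i] prime_gt_0_nat [OF p] by (metis mult_pos_pos of_int_0_less_iff of_nat_0_less_iff)
    moreover have "a dvd int p"
      using ak by (metis dvd_triv_left)
    ultimately have "a = 1 \<or> a = int p"
      using p by (metis dual_order.strict_iff_order prime_int_iff prime_nat_int_transfer)
    moreover have "a \<noteq> int p"
    proof
      assume "a = int p"
      then have "m i = 1"
        using a prime_gt_0_nat [OF p] by simp
      then have "c i \<in> lattice_points" "b i \<in> \<int>"
        using y inner_integral [OF y lat [OF j(1)]] by (auto simp: c_y b_y lattice_points_def)
      then show False using frac [OF i] by blast
    qed
    ultimately show ?thesis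
      using a prime_gt_0_nat [OF p] by (simp add: field_simps)
  qed
  have "lattice_combination v (\<lambda>i. 1 / real p)"
    using m_lat by (simp add: lattice_combination_def m_eq)
  moreover have "real (CARD('n) + 1) = real (r * p)"
    using m_sum prime_gt_0_nat [OF p] by (simp add: m_eq field_simps)
  ultimately show ?thesis
    by (metis of_nat_eq_iff)
qed

text \<open>
Translate by \<open>w = - (\<Sum>v i) / p\<close>. Then the origin has equal weights \<open>1 / (p r)\<close> in \<open>r \<Delta> + w\<close>, so the
dual vertices are the integral vectors \<open>- p *\<^sub>R c i\<close>. An interior lattice point \<open>x\<close> has
\<open>p * (c i \<bullet> x) > - 1\<close>; these integers are then nonnegative, and as they sum to \<open>0\<close>, \<open>x = 0\<close>.
\<close>

lemma (in barycentric) uniform_combination_imp_gorenstein: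
  fixes p r :: nat
  assumes p: "p > 0" and r: "r > 0"
    and lat: "\<And>i. i \<le> CARD('n) \<Longrightarrow> v i \<in> lattice_points"
    and denom: "\<And>t i. lattice_combination v t \<Longrightarrow> i \<le> CARD('n) \<Longrightarrow> real p * t i \<in> \<int>"
    and unif: "lattice_combination v (\<lambda>i. 1 / real p)" and d: "CARD('n) + 1 = r * p"
    and full: "full_lattice_polytope (convex hull (v ` {..CARD('n)}))"
  shows "gorenstein r (convex hull (v ` {..CARD('n)}))"
proof -
  define w where "w = - (\<Sum>i\<le>CARD('n). (1 / real p) *\<^sub>R v i)"
  have w: "w \<in> lattice_points"
    using unif by (auto simp: w_def lattice_combination_def lattice_points_def)
  let ?v = "\<lambda>i. real r *\<^sub>R v i + w" and ?c = "\<lambda>i. (1 / real r) *\<^sub>R c i"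
  let ?b = "\<lambda>i. b i - (c i \<bullet> w) / real r" and ?Q = "convex hull ((\<lambda>i. real r *\<^sub>R v i + w) ` {..CARD('n)})"
  interpret Q: barycentric ?v ?c ?b
    using r by (intro barycentric_image) simp
  have image: "?Q = (\<lambda>x. real r *\<^sub>R x + w) ` (convex hull (v ` {..CARD('n)}))"
    using convex_hull_affinity [of w "real r" "v ` {..CARD('n)}"] by (simp add: image_image add.commute)
  have "(\<Sum>i\<le>CARD('n). 1 / real p) = real r"
  proof -
    have "(\<Sum>i\<le>CARD('n). 1 / real p) = real (CARD('n) + 1) / real p"
      by simp
    then show ?thesis unfolding d using p by simp
  qed
  then have coord: "1 / real p = c i \<bullet> - w + real r * b i" if "i \<le> CARD('n)" for i
    using that by (intro coord_unique [of "\<lambda>i. 1 / real p"]) (simp_all add: w_def)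
  have b_eq: "?b i = 1 / (real p * real r)" if "i \<le> CARD('n)" for i
  proof -
    have "?b i = (c i \<bullet> - w + real r * b i) / real r"
      using r by (simp add: field_simps)
    also have "\<dots> = 1 / real p / real r"
      using coord that by simp
    finally show ?thesis by simp
  qed
  have b_pos: "0 < ?b i" if "i \<le> CARD('n)" for i
    using b_eq [OF that] p r by simp
  have c_int: "real p * (c i \<bullet> x) \<in> \<int>" if "x \<in> lattice_points" "i \<le> CARD('n)" for i x
    using that by (intro denom) (auto simp: lattice_combination_def c_comb c_sum)
  have axis: "axis l 1 \<in> lattice_points" for l :: 'n
    by (auto simp: lattice_points_def axis_def)
  have y: "- (1 / ?b i) *\<^sub>R ?c i \<in> lattice_points" if i: "i \<le> CARD('n)" for i
  proof -
    have eq: "- (1 / ?b i) *\<^sub>R ?c i = - (real p *\<^sub>R c i)"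
      unfolding b_eq [OF i] using r by simp
    have "real p * c i $ l \<in> \<int>" for l
      using c_int [OF axis i, of l] by (simp add: inner_axis)
    then show ?thesis
      unfolding eq by (simp add: lattice_points_def)
  qed
  have hull_lattice: "lattice_polytope (convex hull (f ` {..CARD('n)}))"
    if "\<And>i. i \<le> CARD('n) \<Longrightarrow> f i \<in> lattice_points" for f :: "nat \<Rightarrow> real ^ 'n"
    unfolding lattice_polytope_def vertices_def
    using that by (auto intro!: polytope_convex_hull dest!: extreme_point_of_convex_hull)
  have zero: "0 \<in> interior ?Q"
    unfolding Q.interior_eq using b_pos by simp
  have "interior ?Q \<inter> lattice_points = {0}"
  proof (intro equalityI subsetI)
    fix x assume "x \<in> interior ?Q \<inter> lattice_points"
    then have x: "x \<in> lattice_points" and "\<And>i. i \<le> CARD('n) \<Longrightarrow> 0 < ?c i \<bullet> x + ?b i"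
      by (auto simp: Q.interior_eq)
    then have "0 < (c i \<bullet> x) / real r + 1 / (real p * real r)" if "i \<le> CARD('n)" for i
      using that b_eq [OF that] by fastforce
    then have gt: "- 1 < real p * (c i \<bullet> x)" if "i \<le> CARD('n)" for i
      using that p r by (fastforce simp: field_simps)
    have nonneg: "0 \<le> real p * (c i \<bullet> x)" if i: "i \<le> CARD('n)" for i
    proof -
      obtain k :: int where k: "real p * (c i \<bullet> x) = of_int k"
        using c_int [OF x i] by (auto elim: Ints_cases)
      then show ?thesis using gt [OF i] by simp
    qed
    have "(\<Sum>i\<le>CARD('n). real p * (c i \<bullet> x)) = 0"
      by (simp add: sum_distrib_left [symmetric] c_sum)
    then have "c i \<bullet> x = 0" if "i \<le> CARD('n)" for i
      using sum_nonneg_eq_0_iff [of "{..CARD('n)}" "\<lambda>i. real p * (c i \<bullet> x)"] nonneg that p by auto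
    then have "(\<Sum>i\<le>CARD('n). (c i \<bullet> x) *\<^sub>R v i) = 0"
      by simp
    then show "x \<in> {0}"
      by (simp add: c_comb)
  next
    fix x :: "real ^ 'n" assume "x \<in> {0}"
    then show "x \<in> interior ?Q \<inter> lattice_points"
      using zero by (simp add: lattice_points_def)
  qed
  moreover have "full_lattice_polytope ?Q"
    unfolding full_lattice_polytope_def
  proof
    show "lattice_polytope ?Q"
      using lat w by (intro hull_lattice) (auto simp: lattice_points_def)
    show "aff_dim ?Q = int CARD('n)"
      using aff_dim_nonempty_interior [of ?Q] zero by auto
  qed
  moreover have "lattice_polytope (dual_polytope ?Q)"
  proof -
    have "dual_polytope ?Q = convex hull ((\<lambda>i. - (1 / ?b i) *\<^sub>R ?c i) ` {..CARD('n)})"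
      by (rule Q.dual_polytope_eq) (rule b_pos)
    moreover have "lattice_polytope (convex hull ((\<lambda>i. - (1 / ?b i) *\<^sub>R ?c i) ` {..CARD('n)}))"
      by (rule hull_lattice) (rule y)
    ultimately show ?thesis by simp
  qed
  ultimately have "reflexive_polytope ?Q"
    by (simp add: reflexive_polytope_def)
  with r full w image show ?thesis
    unfolding gorenstein_def by blast
qed

theorem theorem0p1:
  fixes p r :: nat
    and \<Delta> :: "(real ^ 'n) set"
    and v :: "nat \<Rightarrow> real ^ 'n"
  assumes "prime p"
    and "r > 0"
    and "lattice_polytope \<Delta>"
    and "int CARD('n) simplex \<Delta>"
    and "bij_betw v {..CARD('n)} (vertices \<Delta>)"
    and "normalized_volume \<Delta> = real p"
    and "\<not> is_lattice_pyramid \<Delta>"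
  shows "gorenstein r \<Delta> \<longleftrightarrow>
    CARD('n) = r * p - 1 \<and>
    Lambda_group v =
      generate (circle_power CARD('n)) {\<lambda>i\<in>{..CARD('n)}. circle_class (1 / real p)}"
proof -
  have p: "p > 0" "real p \<noteq> 0"
    using prime_gt_0_nat [OF assms(1)] by auto
  obtain C where C: "\<not> affine_dependent C" "int (card C) = int CARD('n) + 1" "\<Delta> = convex hull C"
    using assms(4) unfolding simplex_def by blast
  have "vertices \<Delta> = C"
    using C by (auto simp: vertices_def extreme_point_of_convex_hull_affine_independent)
  with assms(5) have inj: "inj_on v {..CARD('n)}" and vC: "v ` {..CARD('n)} = C"
    by (auto simp: bij_betw_def)
  have \<Delta>: "\<Delta> = convex hull (v ` {..CARD('n)})"
    by (simp add: C vC)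
  have lat: "v i \<in> lattice_points" if "i \<le> CARD('n)" for i
    using assms(3) \<open>vertices \<Delta> = C\<close> vC that by (auto simp: lattice_polytope_def)
  obtain c b where "barycentric v c b"
    using affine_independent_imp_barycentric [of v C] assms(5) \<open>vertices \<Delta> = C\<close> C(1) by auto
  then interpret barycentric v c b .
  have full: "full_lattice_polytope \<Delta>"
    unfolding full_lattice_polytope_def using assms(3) C(2) aff_dim_affine_independent [OF C(1)]
    by (simp add: C(3) aff_dim_convex_hull)
  have vol: "fact CARD('n) * measure lborel (convex hull (v ` {..CARD('n)})) = real p"
  proof -
    have "convex hull (v ` {..CARD('n)}) \<in> sets lborel"
      by (simp add: borel_compact finite_imp_compact_convex_hull)
    then show ?thesis
      using assms(6) by (simp add: normalized_volume_def \<Delta> measure_completion)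
  qed
  have denom: "real p * t i \<in> \<int>" if "lattice_combination v t" "i \<le> CARD('n)" for t i
    using that by (intro lattice_combination_denominator [OF inj lat vol]) auto
  have frac: "c i \<notin> lattice_points \<or> b i \<notin> \<int>" if "i \<le> CARD('n)" for i
    using assms(7) lattice_pyramid_criterion [of v i "c i" "b i"] C(1) inj lat that delta [OF that]
    by (auto simp: \<Delta> vC)
  have gor_iff: "gorenstein r \<Delta> \<longleftrightarrow> lattice_combination v (\<lambda>i. 1 / real p) \<and> CARD('n) + 1 = r * p"
  proof
    assume "gorenstein r \<Delta>"
    then show "lattice_combination v (\<lambda>i. 1 / real p) \<and> CARD('n) + 1 = r * p"
      by (intro gorenstein_imp_uniform_combination [OF assms(1)] lat denom frac) (simp_all add: \<Delta>)
  next
    assume "lattice_combination v (\<lambda>i. 1 / real p) \<and> CARD('n) + 1 = r * p"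
    then show "gorenstein r \<Delta>"
      using full unfolding \<Delta>
      by (intro uniform_combination_imp_gorenstein [OF p(1) assms(2)] lat denom) simp_all
  qed
  have d_iff: "CARD('n) + 1 = r * p \<longleftrightarrow> CARD('n) = r * p - 1"
    using p assms(2) by (cases "r * p") auto
  have gen: "generate (circle_power CARD('n)) {\<lambda>i\<in>{..CARD('n)}. circle_class (1 / real p)}
    = range (\<lambda>k :: int. \<lambda>i\<in>{..CARD('n)}. circle_class (of_int k / real p))"
    by (simp add: generate_diagonal_class)
  have "Lambda_group v = range (\<lambda>k :: int. \<lambda>i\<in>{..CARD('n)}. circle_class (of_int k / real p))
      \<longleftrightarrow> lattice_combination v (\<lambda>i. 1 / real p)" if d: "CARD('n) + 1 = r * p"
  proof
    assume "Lambda_group v = range (\<lambda>k :: int. \<lambda>i\<in>{..CARD('n)}. circle_class (of_int k / real p))"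
    then have "(\<lambda>i\<in>{..CARD('n)}. circle_class (of_int 1 / real p)) \<in> Lambda_group v"
      by (metis rangeI)
    then obtain t where t: "lattice_combination v t"
      and eq: "(\<lambda>i\<in>{..CARD('n)}. circle_class (of_int 1 / real p)) = (\<lambda>i\<in>{..CARD('n)}. circle_class (t i))"
      unfolding Lambda_group_eq by blast
    have "t i - 1 / real p \<in> \<int>" if "i \<le> CARD('n)" for i
      using fun_cong [OF eq, of i] that by (simp add: circle_class_eq_iff) (metis Ints_minus minus_diff_eq)
    then have "(\<Sum>i\<le>CARD('n). (t i - 1 / real p) *\<^sub>R v i) \<in> lattice_points" "(\<Sum>i\<le>CARD('n). t i - 1 / real p) \<in> \<int>"
      using lat by (auto intro!: lattice_points_sum lattice_points_scale Ints_sum)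
    with t have "(\<Sum>i\<le>CARD('n). t i *\<^sub>R v i) - (\<Sum>i\<le>CARD('n). (t i - 1 / real p) *\<^sub>R v i) \<in> lattice_points"
      "(\<Sum>i\<le>CARD('n). t i) - (\<Sum>i\<le>CARD('n). t i - 1 / real p) \<in> \<int>"
      by (auto simp: lattice_combination_def intro: lattice_points_diff)
    then show "lattice_combination v (\<lambda>i. 1 / real p)"
      unfolding lattice_combination_def sum_subtractf [symmetric] scaleR_left_diff_distrib [symmetric]
      by simp
  next
    assume unif: "lattice_combination v (\<lambda>i. 1 / real p)"
    show "Lambda_group v = range (\<lambda>k :: int. \<lambda>i\<in>{..CARD('n)}. circle_class (of_int k / real p))"
    proof (intro equalityI subsetI)
      fix l assume "l \<in> Lambda_group v"
      then obtain t where t: "lattice_combination v t" and l: "l = (\<lambda>i\<in>{..CARD('n)}. circle_class (t i))"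
        unfolding Lambda_group_eq by blast
      obtain k :: int where k: "real p * t 0 = of_int k"
        using denom [OF t, of 0] by (auto elim: Ints_cases)
      then have "t 0 = of_int k / real p"
        using p by (simp add: field_simps)
      moreover have "t i - t 0 \<in> \<int>" if "i \<le> CARD('n)" for i
        using that by (intro lattice_combination_congruent [OF inj lat vol _ p(2) unif t]) auto
      ultimately have "l = (\<lambda>i\<in>{..CARD('n)}. circle_class (of_int k / real p))"
        unfolding l by (intro restrict_ext) (simp add: circle_class_eq_iff)
      then show "l \<in> range (\<lambda>k :: int. \<lambda>i\<in>{..CARD('n)}. circle_class (of_int k / real p))"
        by (rule image_eqI) simp
    next
      fix l assume "l \<in> range (\<lambda>k :: int. \<lambda>i\<in>{..CARD('n)}. circle_class (of_int k / real p))"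
      then obtain k :: int where l: "l = (\<lambda>i\<in>{..CARD('n)}. circle_class (of_int k / real p))"
        by blast
      have "(\<Sum>i\<le>CARD('n). (of_int k / real p) *\<^sub>R v i) = of_int k *\<^sub>R (\<Sum>i\<le>CARD('n). (1 / real p) *\<^sub>R v i)"
        "(\<Sum>i\<le>CARD('n). of_int k / real p) = of_int k * (\<Sum>i\<le>CARD('n). 1 / real p)"
        by (simp_all only: scaleR_sum_right sum_distrib_left scaleR_scaleR times_divide_eq_right mult_1_right)
      then have "lattice_combination v (\<lambda>i. of_int k / real p)"
        using unif unfolding lattice_combination_def by (metis Ints_mult Ints_of_int lattice_points_scale)
      then show "l \<in> Lambda_group v"
        unfolding Lambda_group_eq l by (intro image_eqI [where x = "\<lambda>i. of_int k / real p"]) simp_all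
    qed
  qed
  then show ?thesis
    unfolding gor_iff gen d_iff [symmetric] by blast
qed

end
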